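(* Let $(X,d,\mu,\mathcal{E},\mathcal{F})$ be a non-local regular symmetric Dirichlet space on an Ahlfors $d_H$-regular metric measure space, with conservative semigroup whose heat kernel satisfies, for some $c_3,\ldots,c_6\in(0,\infty)$ and $0<d_W\le d_H+1$, \[ c_5t^{-\frac{d_H}{d_W}}\left(1+c_6\frac{d(x,y)}{t^{1/d_W}}\right)^{-d_H-d_W}\le p_t(x,y)\le c_3t^{-\frac{d_H}{d_W}}\left(1+c_4\frac{d(x,y)}{t^{1/d_W}}\right)^{-d_H-d_W}. \] Assume that there exists a constant $C>0$ such that for every $f\in L^1(X,\mu)$ with $\sup_{r>0}r^{-(d_H+1)}\iint_{\Delta_r}|f(x)-f(y)|\,d\mu(x)\,d\mu(y)<\infty$, \[ \sup_{\varepsilon>0}\frac1{\varepsilon^{d_H+1}}\iint_{\Delta_\varepsilon}|f(y)-f(x)|\,d\mu(x)\,d\mu(y)\le C\limsup_{\varepsilon\to0^+}\frac1{\varepsilon^{d_H+1}}\iint_{\Delta_\varepsilon}|f(y)-f(x)|\,d\mu(x)\,d\mu(y). \] Let $\alpha_1^*(X)=\inf\{\alpha>0:\mathbf{B}^{1,\alpha}(X)\text{ is trivial}\}$. Then \[ \alpha_1^*(X)=\begin{cases}1&\text{if }d_W\le1,\\ \frac1{d_W}&\text{if }d_W>1.\end{cases} \] Moreover, if $d_W\le1$, then \[ \mathbf{B}^{1,\alpha_1^*(X)}(X)=\left\{f\in L^1(X,\mu):\iint\frac{|f(x)-f(y)|}{d(x,y)^{d_H+d_W}}\,d\mu(x)\,d\mu(y)<+\infty\right\},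 \] and if $d_W>1$, then \[ \mathbf{B}^{1,\alpha_1^*(X)}(X)=\left\{f\in L^1(X,\mu):\sup_{r>0}\iint_{\Delta_r}\frac{|f(x)-f(y)|}{r^{d_H+1}}\,d\mu(x)\,d\mu(y)<+\infty\right\}. \]
   Context: $(X,d,\mu)$ is a metric measure space whose balls $B(x,r)=\{y:d(x,y)<r\}$ have compact closure. Ahlfors $d_H$-regular: there are $c_1,c_2,d_H\in(0,\infty)$ with $c_1r^{d_H}\le\mu(B(x,r))\le c_2r^{d_H}$ for all $x\in X$, $r\in(0,\infty)$. The heat kernel bounds hold for $\mu\times\mu$-a.e. $(x,y)$ and all $t\in(0,\infty)$. $\Delta_r=\{(x,y)\in X\times X:d(x,y)<r\}$. For $\alpha\ge0$ and $f\in L^1(X,\mu)$, $\|f\|_{1,\alpha}=\sup_{t>0}t^{-\alpha}\int_X\int_X|f(x)-f(y)|p_t(x,y)\,d\mu(x)\,d\mu(y)$ and $\mathbf{B}^{1,\alpha}(X)=\{f\in L^1(X,\mu):\|f\|_{1,\alpha}<\infty\}$. $\mathbf{B}^{1,\alpha}(X)$ is trivial if each of its elements is ($\mu$-a.e.) constant. *)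

theory Defs
  imports "HOL-Analysis.Analysis"
begin

section \<open>Metric measure spaces\<close>

text \<open>The space is the whole type. Relative compactness of the balls makes it separable and
  locally compact.\<close>

definition metric_measure_space :: "'a::metric_space measure \<Rightarrow> bool" where
  "metric_measure_space M \<longleftrightarrow>
     sets M = sets borel \<and> (\<forall>(x::'a) r. compact (closure (ball x r)))"

definition ahlfors_regular :: "'a::metric_space measure \<Rightarrow> real \<Rightarrow> bool" where
  "ahlfors_regular M d\<^sub>H \<longleftrightarrow> 0 < d\<^sub>H \<and>
     (\<exists>c\<^sub>1>0. \<exists>c\<^sub>2>0. \<forall>x. \<forall>r>0.
        ennreal (c\<^sub>1 * r powr d\<^sub>H) \<le> emeasure M (ball x r) \<and>
        emeasure M (ball x r) \<le> ennreal (c\<^sub>2 * r powr d\<^sub>H))"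

section \<open>Dirichlet forms\<close>

text \<open>Elements of \<open>L\<^sup>2\<close> are represented by functions; everything below that refers to \<open>L\<^sup>2\<close>
  is required to be compatible with almost everywhere equality.\<close>

definition L2_space :: "'a measure \<Rightarrow> ('a \<Rightarrow> real) set" where
  "L2_space M = {f \<in> borel_measurable M. integrable M (\<lambda>x. (f x)\<^sup>2)}"

definition L2_inner :: "'a measure \<Rightarrow> ('a \<Rightarrow> real) \<Rightarrow> ('a \<Rightarrow> real) \<Rightarrow> real" where
  "L2_inner M f g = (\<integral>x. f x * g x \<partial>M)"

definition L2_sqnorm :: "'a measure \<Rightarrow> ('a \<Rightarrow> real) \<Rightarrow> real" where
  "L2_sqnorm M f = L2_inner M f f"

text \<open>Densely defined, nonnegative definite, symmetric bilinear forms with domain \<open>F\<close>.\<close>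

definition symmetric_form ::
  "'a measure \<Rightarrow> (('a \<Rightarrow> real) \<Rightarrow> ('a \<Rightarrow> real) \<Rightarrow> real) \<Rightarrow> ('a \<Rightarrow> real) set \<Rightarrow> bool" where
  "symmetric_form M E F \<longleftrightarrow>
     F \<subseteq> L2_space M \<and>
     (\<lambda>x. 0) \<in> F \<and>
     (\<forall>u\<in>F. \<forall>v\<in>F. (\<lambda>x. u x + v x) \<in> F) \<and>
     (\<forall>c. \<forall>u\<in>F. (\<lambda>x. c * u x) \<in> F) \<and>
     (\<forall>u\<in>F. \<forall>v\<in>borel_measurable M. (AE x in M. u x = v x) \<longrightarrow>
        v \<in> F \<and> (\<forall>w\<in>F. E v w = E u w)) \<and>
     (\<forall>f\<in>L2_space M. \<forall>\<epsilon>>0. \<exists>u\<in>F. L2_sqnorm M (\<lambda>x. f x - u x) < \<epsilon>) \<and>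
     (\<forall>u\<in>F. \<forall>v\<in>F. E u v = E v u) \<and>
     (\<forall>u\<in>F. \<forall>v\<in>F. \<forall>w\<in>F. E (\<lambda>x. u x + v x) w = E u w + E v w) \<and>
     (\<forall>c. \<forall>u\<in>F. \<forall>v\<in>F. E (\<lambda>x. c * u x) v = c * E u v) \<and>
     (\<forall>u\<in>F. 0 \<le> E u u)"

definition form_sqnorm ::
  "'a measure \<Rightarrow> (('a \<Rightarrow> real) \<Rightarrow> ('a \<Rightarrow> real) \<Rightarrow> real) \<Rightarrow> ('a \<Rightarrow> real) \<Rightarrow> real" where
  "form_sqnorm M E u = E u u + L2_sqnorm M u"

definition closed_form ::
  "'a measure \<Rightarrow> (('a \<Rightarrow> real) \<Rightarrow> ('a \<Rightarrow> real) \<Rightarrow> real) \<Rightarrow> ('a \<Rightarrow> real) set \<Rightarrow> bool" where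
  "closed_form M E F \<longleftrightarrow>
     (\<forall>u :: nat \<Rightarrow> 'a \<Rightarrow> real.
        (\<forall>n. u n \<in> F) \<and>
        (\<forall>\<epsilon>>0. \<exists>N. \<forall>m\<ge>N. \<forall>n\<ge>N. form_sqnorm M E (\<lambda>x. u m x - u n x) < \<epsilon>) \<longrightarrow>
        (\<exists>v\<in>F. (\<lambda>n. form_sqnorm M E (\<lambda>x. u n x - v x)) \<longlonglongrightarrow> 0))"

definition markovian_form ::
  "(('a \<Rightarrow> real) \<Rightarrow> ('a \<Rightarrow> real) \<Rightarrow> real) \<Rightarrow> ('a \<Rightarrow> real) set \<Rightarrow> bool" where
  "markovian_form E F \<longleftrightarrow>
     (\<forall>u\<in>F. (\<lambda>x. min (max (u x) 0) 1) \<in> F \<and>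
        E (\<lambda>x. min (max (u x) 0) 1) (\<lambda>x. min (max (u x) 0) 1) \<le> E u u)"

definition dirichlet_form ::
  "'a measure \<Rightarrow> (('a \<Rightarrow> real) \<Rightarrow> ('a \<Rightarrow> real) \<Rightarrow> real) \<Rightarrow> ('a \<Rightarrow> real) set \<Rightarrow> bool" where
  "dirichlet_form M E F \<longleftrightarrow>
     symmetric_form M E F \<and> closed_form M E F \<and> markovian_form E F"

definition Cc_space :: "('a::metric_space \<Rightarrow> real) set" where
  "Cc_space = {g. continuous_on UNIV g \<and> compact (closure {x. g x \<noteq> 0})}"

definition regular_form ::
  "'a::metric_space measure \<Rightarrow> (('a \<Rightarrow> real) \<Rightarrow> ('a \<Rightarrow> real) \<Rightarrow> real) \<Rightarrow> ('a \<Rightarrow> real) set \<Rightarrow> bool" where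
  "regular_form M E F \<longleftrightarrow>
     (\<forall>g\<in>Cc_space. \<forall>\<epsilon>>0. \<exists>h\<in>Cc_space \<inter> F. \<forall>x. \<bar>g x - h x\<bar> < \<epsilon>) \<and>
     (\<forall>u\<in>F. \<forall>\<epsilon>>0. \<exists>h\<in>Cc_space \<inter> F. form_sqnorm M E (\<lambda>x. u x - h x) < \<epsilon>)"

text \<open>The support of the measure with density \<open>\<bar>u\<bar>\<close>, which depends only on the
  almost everywhere class of \<open>u\<close>.\<close>

definition ess_support :: "'a::metric_space measure \<Rightarrow> ('a \<Rightarrow> real) \<Rightarrow> 'a set" where
  "ess_support M u = - \<Union>{U. open U \<and> (AE x in M. x \<in> U \<longrightarrow> u x = 0)}"

definition local_form ::
  "'a::metric_space measure \<Rightarrow> (('a \<Rightarrow> real) \<Rightarrow> ('a \<Rightarrow> real) \<Rightarrow> real) \<Rightarrow> ('a \<Rightarrow> real) set \<Rightarrow> bool" where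
  "local_form M E F \<longleftrightarrow>
     (\<forall>u\<in>F. \<forall>v\<in>F.
        compact (ess_support M u) \<and> compact (ess_support M v) \<and>
        ess_support M u \<inter> ess_support M v = {} \<longrightarrow> E u v = 0)"

section \<open>Semigroup and heat kernel\<close>

text \<open>Strongly continuous semigroups \<open>(P\<^sub>t)\<^sub>t\<^sub>>\<^sub>0\<close> of symmetric linear contractions
  on \<open>L\<^sup>2\<close>; values of \<open>P\<close> at nonpositive times are irrelevant.\<close>

definition L2_semigroup ::
  "'a measure \<Rightarrow> (real \<Rightarrow> ('a \<Rightarrow> real) \<Rightarrow> ('a \<Rightarrow> real)) \<Rightarrow> bool" where
  "L2_semigroup M P \<longleftrightarrow>
     (\<forall>t>0. \<forall>f\<in>L2_space M. P t f \<in> L2_space M) \<and>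
     (\<forall>t>0. \<forall>f\<in>L2_space M. \<forall>g\<in>L2_space M.
        (AE x in M. f x = g x) \<longrightarrow> (AE x in M. P t f x = P t g x)) \<and>
     (\<forall>t>0. \<forall>f\<in>L2_space M. \<forall>g\<in>L2_space M. \<forall>a b.
        AE x in M. P t (\<lambda>y. a * f y + b * g y) x = a * P t f x + b * P t g x) \<and>
     (\<forall>t>0. \<forall>f\<in>L2_space M. \<forall>g\<in>L2_space M. L2_inner M (P t f) g = L2_inner M f (P t g)) \<and>
     (\<forall>t>0. \<forall>f\<in>L2_space M. L2_sqnorm M (P t f) \<le> L2_sqnorm M f) \<and>
     (\<forall>s>0. \<forall>t>0. \<forall>f\<in>L2_space M. AE x in M. P s (P t f) x = P (s + t) f x) \<and>
     (\<forall>f\<in>L2_space M. ((\<lambda>t. L2_sqnorm M (\<lambda>x. P t f x - f x)) \<longlongrightarrow> 0) (at_right 0))"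

text \<open>\<open>u\<close> lies in the domain of the infinitesimal generator of \<open>P\<close> and is mapped to \<open>f\<close>.\<close>

definition semigroup_generator ::
  "'a measure \<Rightarrow> (real \<Rightarrow> ('a \<Rightarrow> real) \<Rightarrow> ('a \<Rightarrow> real)) \<Rightarrow> ('a \<Rightarrow> real) \<Rightarrow> ('a \<Rightarrow> real) \<Rightarrow> bool" where
  "semigroup_generator M P u f \<longleftrightarrow>
     u \<in> L2_space M \<and> f \<in> L2_space M \<and>
     ((\<lambda>t. L2_sqnorm M (\<lambda>x. (P t u x - u x) / t - f x)) \<longlongrightarrow> 0) (at_right 0)"

text \<open>\<open>u\<close> lies in the domain of the self-adjoint operator \<open>L\<close> determined by
  \<open>E u v = - \<langle>L u, v\<rangle>\<close>, and \<open>L u = f\<close>.\<close>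

definition form_generator ::
  "'a measure \<Rightarrow> (('a \<Rightarrow> real) \<Rightarrow> ('a \<Rightarrow> real) \<Rightarrow> real) \<Rightarrow> ('a \<Rightarrow> real) set \<Rightarrow>
   ('a \<Rightarrow> real) \<Rightarrow> ('a \<Rightarrow> real) \<Rightarrow> bool" where
  "form_generator M E F u f \<longleftrightarrow>
     u \<in> F \<and> f \<in> L2_space M \<and> (\<forall>v\<in>F. E u v = - L2_inner M f v)"

text \<open>\<open>P\<close> is the semigroup \<open>exp (t L)\<close> of the form: the semigroup generated by \<open>L\<close>.\<close>

definition semigroup_of_form ::
  "'a measure \<Rightarrow> (('a \<Rightarrow> real) \<Rightarrow> ('a \<Rightarrow> real) \<Rightarrow> real) \<Rightarrow> ('a \<Rightarrow> real) set \<Rightarrow>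
   (real \<Rightarrow> ('a \<Rightarrow> real) \<Rightarrow> ('a \<Rightarrow> real)) \<Rightarrow> bool" where
  "semigroup_of_form M E F P \<longleftrightarrow>
     L2_semigroup M P \<and> (\<forall>u f. semigroup_generator M P u f \<longleftrightarrow> form_generator M E F u f)"

text \<open>\<open>P\<^sub>t 1 = 1\<close>. Since \<open>1\<close> need not be in \<open>L\<^sup>2\<close>, this refers to the usual extension
  of a positivity preserving semigroup along increasing sequences in \<open>L\<^sup>2\<close>.\<close>

definition conservative ::
  "'a measure \<Rightarrow> (real \<Rightarrow> ('a \<Rightarrow> real) \<Rightarrow> ('a \<Rightarrow> real)) \<Rightarrow> bool" where
  "conservative M P \<longleftrightarrow>
     (\<forall>t>0. \<forall>f :: nat \<Rightarrow> 'a \<Rightarrow> real.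
        (\<forall>n. f n \<in> L2_space M) \<and>
        (AE x in M. (\<forall>n. 0 \<le> f n x \<and> f n x \<le> f (Suc n) x) \<and> (\<lambda>n. f n x) \<longlonglongrightarrow> 1) \<longrightarrow>
        (AE x in M. (\<lambda>n. P t (f n) x) \<longlonglongrightarrow> 1))"

definition heat_kernel ::
  "'a measure \<Rightarrow> (real \<Rightarrow> ('a \<Rightarrow> real) \<Rightarrow> ('a \<Rightarrow> real)) \<Rightarrow> (real \<Rightarrow> 'a \<Rightarrow> 'a \<Rightarrow> real) \<Rightarrow> bool" where
  "heat_kernel M P p \<longleftrightarrow>
     (\<forall>t>0. (\<lambda>(x, y). p t x y) \<in> borel_measurable (M \<Otimes>\<^sub>M M) \<and>
        (AE (x, y) in M \<Otimes>\<^sub>M M. 0 \<le> p t x y) \<and>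
        (\<forall>f\<in>L2_space M. AE x in M.
           integrable M (\<lambda>y. p t x y * f y) \<and> P t f x = (\<integral>y. p t x y * f y \<partial>M)))"

section \<open>Besov classes\<close>

definition L1_space :: "'a measure \<Rightarrow> ('a \<Rightarrow> real) set" where
  "L1_space M = {f. integrable M f}"

definition besov_seminorm ::
  "'a measure \<Rightarrow> (real \<Rightarrow> 'a \<Rightarrow> 'a \<Rightarrow> real) \<Rightarrow> real \<Rightarrow> ('a \<Rightarrow> real) \<Rightarrow> ennreal" where
  "besov_seminorm M p \<alpha> f =
     (SUP t\<in>{0<..}. ennreal (t powr - \<alpha>) *
        (\<integral>\<^sup>+ y. \<integral>\<^sup>+ x. ennreal (\<bar>f x - f y\<bar> * p t x y) \<partial>M \<partial>M))"

definition besov ::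
  "'a measure \<Rightarrow> (real \<Rightarrow> 'a \<Rightarrow> 'a \<Rightarrow> real) \<Rightarrow> real \<Rightarrow> ('a \<Rightarrow> real) set" where
  "besov M p \<alpha> = {f \<in> L1_space M. besov_seminorm M p \<alpha> f < \<infinity>}"

definition trivial_space :: "'a measure \<Rightarrow> ('a \<Rightarrow> real) set \<Rightarrow> bool" where
  "trivial_space M B \<longleftrightarrow> (\<forall>f\<in>B. \<exists>c. AE x in M. f x = c)"

text \<open>Extended real, so that the infimum of the empty set is infinite.\<close>

definition besov_critical_exponent ::
  "'a measure \<Rightarrow> (real \<Rightarrow> 'a \<Rightarrow> 'a \<Rightarrow> real) \<Rightarrow> ereal" where
  "besov_critical_exponent M p = (INF \<alpha>\<in>{\<alpha>. 0 < \<alpha> \<and> trivial_space M (besov M p \<alpha>)}. ereal \<alpha>)"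

definition near_diagonal :: "real \<Rightarrow> ('a::metric_space \<times> 'a) set" where
  "near_diagonal r = {(x, y). dist x y < r}"

definition korevaar_schoen ::
  "'a::metric_space measure \<Rightarrow> real \<Rightarrow> ('a \<Rightarrow> real) \<Rightarrow> real \<Rightarrow> ennreal" where
  "korevaar_schoen M d\<^sub>H f r =
     ennreal (1 / r powr (d\<^sub>H + 1)) *
       (\<integral>\<^sup>+ z\<in>near_diagonal r. ennreal \<bar>f (fst z) - f (snd z)\<bar> \<partial>(M \<Otimes>\<^sub>M M))"

end

theory Submission
  imports Defs
begin

text \<open>Write \<open>K(r) = \<integral>\<integral>\<^sub>\<Delta>\<^sub>r \<bar>f(x) - f(y)\<bar>\<close>. Bounding the heat kernel from below on \<open>\<Delta>\<^sub>r\<close>, \<open>r = t\<^sup>1\<^sup>/\<^sup>d\<^sup>W\<close>,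
  and from above by a geometric series of indicators of \<open>\<Delta>\<close> at the radii \<open>2\<^sup>k r\<close> shows, for \<open>\<alpha> < 1\<close>, that \<open>f\<close> has
  finite \<open>\<alpha>\<close>-seminorm iff \<open>K(r) = O(r powr (d\<^sub>H + \<alpha> d\<^sub>W))\<close>. A Lipschitz bump satisfies this whenever
  \<open>\<alpha> d\<^sub>W \<le> 1\<close>, so the critical exponent is at least \<open>min 1 (1 / d\<^sub>W)\<close>. If \<open>1 < \<alpha> d\<^sub>W\<close>, the Korevaar-Schoen
  quotient \<open>K(r) / r powr (d\<^sub>H + 1)\<close> tends to \<open>0\<close> as \<open>r \<rightarrow> 0\<close>, and the assumed inequality forces \<open>K = 0\<close>.
  For \<open>\<alpha> \<ge> 1\<close> the kernel dominates \<open>t\<close> times the jump density \<open>d(x,y) powr (- d\<^sub>H - d\<^sub>W)\<close> off \<open>\<Delta>\<^sub>r\<close>, so the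
  jump integral of \<open>f\<close> off \<open>\<Delta>\<^sub>r\<close> is \<open>O(r powr (d\<^sub>W (\<alpha> - 1)))\<close>: letting \<open>r \<rightarrow> 0\<close>, it vanishes when \<open>\<alpha> > 1\<close>
  and is finite when \<open>\<alpha> = 1\<close>.\<close>

section \<open>Weighted suprema as power bounds\<close>

text \<open>For \<open>r > 0\<close> the factor \<open>r powr b\<close> undoes the weight, so the
  finite supremum itself serves as the constant. This turns the Besov seminorm (\<open>b\<close> =
  \<alpha>) and the Korevaar-Schoen supremum (\<open>b = dH + 1\<close>) into bounds with a real
  constant, which can be compared with each other.\<close>

lemma SUP_powr_finite_iff:
  fixes g :: "real \<Rightarrow> ennreal"
  shows "(SUP r\<in>{0<..}. ennreal (r powr - b) * g r) < \<infinity> \<longleftrightarrow>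
    (\<exists>A\<ge>0. \<forall>r>0. g r \<le> ennreal (A * r powr b))" (is "?S < \<infinity> \<longleftrightarrow> _")
proof
  assume fin: "?S < \<infinity>"
  have "g r \<le> ennreal (enn2real ?S * r powr b)" if r: "r > 0" for r
  proof -
    have "ennreal (r powr b) * (ennreal (r powr - b) * g r) = g r"
      using r by (simp add: mult.assoc[symmetric] ennreal_mult[symmetric] powr_add[symmetric])
    moreover have "ennreal (r powr b) * (ennreal (r powr - b) * g r) \<le> ennreal (r powr b) * ?S"
      using r by (intro mult_left_mono SUP_upper) auto
    moreover have "ennreal (r powr b) * ?S = ennreal (enn2real ?S * r powr b)"
      using fin by (simp add: ennreal_mult mult.commute)
    ultimately show ?thesis by simp
  qed
  then show "\<exists>A\<ge>0. \<forall>r>0. g r \<le> ennreal (A * r powr b)"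
    by (intro exI[of _ "enn2real ?S"]) simp
next
  assume "\<exists>A\<ge>0. \<forall>r>0. g r \<le> ennreal (A * r powr b)"
  then obtain A where A: "A \<ge> 0" "\<And>r. r > 0 \<Longrightarrow> g r \<le> ennreal (A * r powr b)"
    by auto
  have "?S \<le> ennreal A"
  proof (rule SUP_least)
    fix r :: real assume "r \<in> {0<..}"
    then have r: "r > 0" by simp
    have "ennreal (r powr - b) * g r \<le> ennreal (r powr - b) * ennreal (A * r powr b)"
      using A(2)[OF r] by (intro mult_left_mono) auto
    also have "\<dots> = ennreal A"
      using r A(1) by (simp add: ennreal_mult[symmetric] powr_add[symmetric] mult.left_commute)
    finally show "ennreal (r powr - b) * g r \<le> ennreal A" .
  qed
  then show "?S < \<infinity>"
    using ennreal_less_top le_less_trans by (metis infinity_ennreal_def)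
qed

section \<open>Oscillation on Ahlfors regular spaces\<close>

locale ahlfors_space =
  fixes M :: "'a::metric_space measure" and dH c1 c2 :: real
  assumes mms: "metric_measure_space M"
    and dH_pos: "0 < dH" and c1_pos: "0 < c1" and c2_pos: "0 < c2"
    and ball_lower: "\<And>x r. 0 < r \<Longrightarrow> ennreal (c1 * r powr dH) \<le> emeasure M (ball x r)"
    and ball_upper: "\<And>x r. 0 < r \<Longrightarrow> emeasure M (ball x r) \<le> ennreal (c2 * r powr dH)"
begin

lemma sets_M[measurable_cong]: "sets M = sets borel"
  using mms by (simp add: metric_measure_space_def)

lemma space_M[simp]: "space M = UNIV"
  using sets_eq_imp_space_eq[OF sets_M] by simp

lemma ball_sets[measurable, simp]: "ball x r \<in> sets M"
  by (simp add: sets_M)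

lemma ball_finite: "emeasure M (ball x r) < \<infinity>"
proof (cases "r > 0")
  case True
  show ?thesis using ball_upper[OF True, of x] ennreal_less_top le_less_trans
    by (metis infinity_ennreal_def)
next
  case False
  then show ?thesis by (simp add: ball_empty)
qed

lemma sigma_finite_M: "sigma_finite_measure M"
proof
  fix x0 :: 'a
  have "(\<Union>n::nat. ball x0 (real n)) = UNIV"
    by (auto simp: reals_Archimedean2)
  then show "\<exists>A. countable A \<and> A \<subseteq> sets M \<and> \<Union> A = space M \<and> (\<forall>a\<in>A. emeasure M a \<noteq> \<infinity>)"
    using ball_finite by (intro exI[of _ "range (\<lambda>n::nat. ball x0 (real n))"]) (auto simp: less_top)
qed

sublocale sigma_finite_measure M by (rule sigma_finite_M)
sublocale MM: pair_sigma_finite M M ..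

text \<open>The type need not be of class \<^class>\<open>second_countable_topology\<close>, so the library rule for
  \<^const>\<open>dist\<close> does not apply; separability comes from the total boundedness of the balls.\<close>

lemma dist_measurable[measurable]:
  "(\<lambda>z. dist (fst z) (snd z)) \<in> borel_measurable (M \<Otimes>\<^sub>M M)"
proof -
  fix x0 :: 'a
  have "\<exists>D. finite D \<and> closure (ball x0 (real n)) \<subseteq> (\<Union>d\<in>D. ball d (1 / real (Suc m)))" for n m
  proof -
    have "compact (closure (ball x0 (real n)))"
      using mms by (simp add: metric_measure_space_def)
    then have "\<forall>e>0. \<exists>k. finite k \<and> closure (ball x0 (real n)) \<subseteq> (\<Union>x\<in>k. ball x e)"
      unfolding compact_eq_totally_bounded by auto
    then show ?thesis by simp
  qed
  then obtain D where D: "\<And>n m. finite (D n m)"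
    "\<And>n m. closure (ball x0 (real n)) \<subseteq> (\<Union>d\<in>D n m. ball d (1 / real (Suc m)))"
    by metis
  define Q where "Q = (\<Union>n m. D n m)"
  have cQ: "countable Q" unfolding Q_def by (intro countable_UN countable_finite[OF D(1)] countableI_type)
  have dense: "\<exists>d\<in>Q. dist d x < e" if e: "e > 0" for x e
  proof -
    obtain n :: nat where n: "dist x0 x < real n" using reals_Archimedean2 by blast
    obtain m where m: "1 / real (Suc m) < e" using e nat_approx_posE by blast
    have "x \<in> closure (ball x0 (real n))" using n closure_subset by fastforce
    then obtain d where "d \<in> D n m" "dist d x < 1 / real (Suc m)" using D(2) by fastforce
    with m show ?thesis unfolding Q_def by (intro bexI[of _ d]) auto
  qed
  \<comment> \<open>The set becomes a countable union of measurable rectangles: \<open>d\<close> is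
    a dense point close to \<open>fst z\<close>, and the rational \<open>q\<close> splits
    \<open>r\<close> into the two radii. Half of the slack pays for moving from \<open>fst z\<close>
    to \<open>d\<close>, the other half for \<open>q\<close>.\<close>
  have eq: "{z. dist (fst z) (snd z) < r} =
      (\<Union>(d, q)\<in>Q \<times> \<rat>. ball d q \<times> ball d (r - q))" (is "?L = ?R") for r
  proof
    show "?R \<subseteq> ?L"
    proof
      fix z assume "z \<in> ?R"
      then obtain d q where "dist d (fst z) < q" "dist d (snd z) < r - q" by auto
      then show "z \<in> ?L" using dist_triangle[of "fst z" "snd z" d] by (simp add: dist_commute)
    qed
    show "?L \<subseteq> ?R"
    proof
      fix z assume "z \<in> ?L"
      then have r: "dist (fst z) (snd z) < r" by simp
      define e where "e = (r - dist (fst z) (snd z)) / 2"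
      have "e > 0" using r by (simp add: e_def)
      then obtain d where d: "d \<in> Q" "dist d (fst z) < e" using dense by blast
      obtain q where q: "q \<in> \<rat>" "dist d (fst z) < q" "q < e" using Rats_dense_in_real[OF d(2)] by blast
      have "dist d (snd z) \<le> dist d (fst z) + dist (fst z) (snd z)" by (rule dist_triangle)
      with d(2) q(3) have "dist d (snd z) < r - q" unfolding e_def by (simp add: field_simps)
      with d(1) q show "z \<in> ?R" by (cases z) auto
    qed
  qed
  show ?thesis
    unfolding borel_measurable_iff_less
  proof
    fix r :: real
    have "(\<Union>(d, q)\<in>Q \<times> \<rat>. ball d q \<times> ball d (r - q)) \<in> sets (M \<Otimes>\<^sub>M M)"
      using cQ countable_rat by (intro sets.countable_UN'') auto
    then show "{w \<in> space (M \<Otimes>\<^sub>M M). dist (fst w) (snd w) < r} \<in> sets (M \<Otimes>\<^sub>M M)"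
      by (simp add: space_pair_measure eq)
  qed
qed

lemma near_diagonal_eq: "near_diagonal r = {z. dist (fst z) (snd z) < r}"
  by (auto simp: near_diagonal_def)

lemma near_diagonal_sets[measurable]: "near_diagonal r \<in> sets (M \<Otimes>\<^sub>M M)"
proof -
  have "{z \<in> space (M \<Otimes>\<^sub>M M). dist (fst z) (snd z) < r} \<in> sets (M \<Otimes>\<^sub>M M)" by measurable
  then show ?thesis by (simp add: near_diagonal_eq space_pair_measure)
qed

text \<open>This is \<open>K(r)\<close>, the integral inside \<open>korevaar_schoen\<close> without
  its weight.\<close>

definition oscillation :: "('a \<Rightarrow> real) \<Rightarrow> real \<Rightarrow> ennreal" where
  "oscillation f r = (\<integral>\<^sup>+ z\<in>near_diagonal r. ennreal \<bar>f (fst z) - f (snd z)\<bar> \<partial>(M \<Otimes>\<^sub>M M))"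

text \<open>By Fubini: every slice of \<open>near_diagonal r\<close>, in either coordinate, is a
  ball of radius \<open>r\<close>, whose measure is at most \<open>c2 * r powr dH\<close>. Each of
  the two summands contributes one such factor.\<close>

lemma near_diagonal_integral_le:
  fixes g :: "'a \<Rightarrow> ennreal"
  assumes [measurable]: "g \<in> borel_measurable M" and r: "r > 0"
  shows "(\<integral>\<^sup>+ z\<in>near_diagonal r. (g (fst z) + g (snd z)) \<partial>(M \<Otimes>\<^sub>M M))
    \<le> ennreal (2 * c2 * r powr dH) * (\<integral>\<^sup>+ x. g x \<partial>M)"
proof -
  have b: "(\<integral>\<^sup>+ y. indicator (near_diagonal r) (x, y) \<partial>M) \<le> ennreal (c2 * r powr dH)"
    "(\<integral>\<^sup>+ y. indicator (near_diagonal r) (y, x) \<partial>M) \<le> ennreal (c2 * r powr dH)" for x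
  proof -
    have "(\<lambda>y. indicator (near_diagonal r) (x, y)) = (indicator (ball x r) :: 'a \<Rightarrow> ennreal)"
      "(\<lambda>y. indicator (near_diagonal r) (y, x)) = (indicator (ball x r) :: 'a \<Rightarrow> ennreal)"
      by (auto simp: near_diagonal_def indicator_def dist_commute)
    then show "(\<integral>\<^sup>+ y. indicator (near_diagonal r) (x, y) \<partial>M) \<le> ennreal (c2 * r powr dH)"
      "(\<integral>\<^sup>+ y. indicator (near_diagonal r) (y, x) \<partial>M) \<le> ennreal (c2 * r powr dH)"
      using ball_upper[OF r, of x] by simp_all
  qed
  have "(\<integral>\<^sup>+ z. g (fst z) * indicator (near_diagonal r) z \<partial>(M \<Otimes>\<^sub>M M))
      = (\<integral>\<^sup>+ x. \<integral>\<^sup>+ y. g x * indicator (near_diagonal r) (x, y) \<partial>M \<partial>M)"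
    by (subst nn_integral_fst[symmetric]) simp_all
  also have "\<dots> = (\<integral>\<^sup>+ x. g x * (\<integral>\<^sup>+ y. indicator (near_diagonal r) (x, y) \<partial>M) \<partial>M)"
    by (intro nn_integral_cong nn_integral_cmult) measurable
  also have "\<dots> \<le> (\<integral>\<^sup>+ x. g x * ennreal (c2 * r powr dH) \<partial>M)"
    by (intro nn_integral_mono mult_left_mono b) auto
  also have "\<dots> = (\<integral>\<^sup>+ x. g x \<partial>M) * ennreal (c2 * r powr dH)"
    by (rule nn_integral_multc) measurable
  finally have 1: "(\<integral>\<^sup>+ z. g (fst z) * indicator (near_diagonal r) z \<partial>(M \<Otimes>\<^sub>M M))
    \<le> (\<integral>\<^sup>+ x. g x \<partial>M) * ennreal (c2 * r powr dH)" .
  have "(\<integral>\<^sup>+ z. g (snd z) * indicator (near_diagonal r) z \<partial>(M \<Otimes>\<^sub>M M))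
      = (\<integral>\<^sup>+ x. \<integral>\<^sup>+ y. g x * indicator (near_diagonal r) (y, x) \<partial>M \<partial>M)"
    by (subst MM.nn_integral_snd[symmetric]) simp_all
  also have "\<dots> = (\<integral>\<^sup>+ x. g x * (\<integral>\<^sup>+ y. indicator (near_diagonal r) (y, x) \<partial>M) \<partial>M)"
    by (intro nn_integral_cong nn_integral_cmult) measurable
  also have "\<dots> \<le> (\<integral>\<^sup>+ x. g x * ennreal (c2 * r powr dH) \<partial>M)"
    by (intro nn_integral_mono mult_left_mono b) auto
  also have "\<dots> = (\<integral>\<^sup>+ x. g x \<partial>M) * ennreal (c2 * r powr dH)"
    by (rule nn_integral_multc) measurable
  finally have 2: "(\<integral>\<^sup>+ z. g (snd z) * indicator (near_diagonal r) z \<partial>(M \<Otimes>\<^sub>M M))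
    \<le> (\<integral>\<^sup>+ x. g x \<partial>M) * ennreal (c2 * r powr dH)" .
  have "(\<integral>\<^sup>+ z\<in>near_diagonal r. (g (fst z) + g (snd z)) \<partial>(M \<Otimes>\<^sub>M M))
    = (\<integral>\<^sup>+ z. g (fst z) * indicator (near_diagonal r) z \<partial>(M \<Otimes>\<^sub>M M))
     + (\<integral>\<^sup>+ z. g (snd z) * indicator (near_diagonal r) z \<partial>(M \<Otimes>\<^sub>M M))"
    by (subst nn_integral_add[symmetric]) (simp_all add: distrib_right)
  also have "\<dots> \<le> (\<integral>\<^sup>+ x. g x \<partial>M) * ennreal (c2 * r powr dH) + (\<integral>\<^sup>+ x. g x \<partial>M) * ennreal (c2 * r powr dH)"
    by (intro add_mono 1 2)
  also have "\<dots> = ennreal (2 * c2 * r powr dH) * (\<integral>\<^sup>+ x. g x \<partial>M)"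
    using c2_pos by (simp add: distrib_left[symmetric] ennreal_plus[symmetric] mult_ac del: ennreal_plus)
  finally show ?thesis .
qed

text \<open>The integrand is at most the sum of the absolute values at the two points. This crude
  bound serves for large radii, where a bound of order \<open>r powr (dH + b)\<close> with
  \<open>b > 1\<close> is too weak.\<close>

lemma oscillation_le:
  assumes f: "integrable M f"
  shows "\<exists>A\<ge>0. \<forall>r>0. oscillation f r \<le> ennreal (A * r powr dH)"
proof -
  have [measurable]: "f \<in> borel_measurable M" using f by simp
  define N where "N = (\<integral> x. \<bar>f x\<bar> \<partial>M)"
  have N: "(\<integral>\<^sup>+ x. ennreal \<bar>f x\<bar> \<partial>M) = ennreal N" "N \<ge> 0"
    unfolding N_def using f by (auto intro!: nn_integral_eq_integral integrable_abs)
  have "oscillation f r \<le> ennreal ((2 * c2 * N) * r powr dH)" if r: "r > 0" for r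
  proof -
    have "oscillation f r \<le> (\<integral>\<^sup>+ z\<in>near_diagonal r. (ennreal \<bar>f (fst z)\<bar> + ennreal \<bar>f (snd z)\<bar>) \<partial>(M \<Otimes>\<^sub>M M))"
      unfolding oscillation_def
      by (intro nn_integral_mono mult_right_mono) (auto simp: ennreal_plus[symmetric] simp del: ennreal_plus intro!: ennreal_leI)
    also have "\<dots> \<le> ennreal (2 * c2 * r powr dH) * ennreal N"
      using near_diagonal_integral_le[of "\<lambda>x. ennreal \<bar>f x\<bar>", OF _ r] N by simp
    also have "\<dots> = ennreal ((2 * c2 * N) * r powr dH)"
      using c2_pos N by (simp add: ennreal_mult[symmetric] mult_ac)
    finally show ?thesis .
  qed
  then show ?thesis using N c2_pos by (intro exI[of _ "2 * c2 * N"]) auto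
qed

text \<open>Fubini gives, for almost every \<open>x\<close>, equality with \<open>f x\<close> almost
  everywhere. Such an \<open>x\<close> exists because the measure is not zero: unit balls have
  positive measure.\<close>

lemma AE_constI:
  assumes "AE z in M \<Otimes>\<^sub>M M. f (fst z) = f (snd z)"
  shows "\<exists>c. AE x in M. f x = c"
proof -
  have "AE x in M. AE y in M. f x = f y"
    using MM.AE_pair[OF assms] by simp
  moreover have "\<not> (AE x in M. False)"
  proof
    fix x0 :: 'a
    assume "AE x in M. False"
    then have "emeasure M (ball x0 1) = 0"
      by (intro AE_iff_measurable[THEN iffD1, rotated 2, of "\<lambda>x. x \<notin> ball x0 1"]) auto
    with ball_lower[of 1 x0] c1_pos show False by simp
  qed
  ultimately obtain x where "AE y in M. f x = f y"
    by (metis (mono_tags, lifting) eventually_mono)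
  then have "AE y in M. f y = f x"
    by eventually_elim simp
  then show ?thesis ..
qed

text \<open>The sets \<open>near_diagonal n\<close> exhaust the product space, and a countable union
  of null sets is null.\<close>

lemma AE_const_if_oscillation_0:
  assumes f[measurable]: "f \<in> borel_measurable M" and 0: "\<And>r. r > 0 \<Longrightarrow> oscillation f r = 0"
  shows "\<exists>c. AE x in M. f x = c"
proof (rule AE_constI)
  have "AE z in M \<Otimes>\<^sub>M M. ennreal \<bar>f (fst z) - f (snd z)\<bar> * indicator (near_diagonal (real (Suc n))) z = 0" for n
    using 0[of "real (Suc n)"] unfolding oscillation_def by (subst nn_integral_0_iff_AE[symmetric]) auto
  then have "AE z in M \<Otimes>\<^sub>M M. \<forall>n. ennreal \<bar>f (fst z) - f (snd z)\<bar> * indicator (near_diagonal (real (Suc n))) z = 0"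
    unfolding AE_all_countable by blast
  then show "AE z in M \<Otimes>\<^sub>M M. f (fst z) = f (snd z)"
  proof eventually_elim
    case (elim z)
    obtain n :: nat where "dist (fst z) (snd z) < real n" using reals_Archimedean2 by blast
    then have "z \<in> near_diagonal (real (Suc n))" by (simp add: near_diagonal_eq)
    then show ?case using elim[rule_format, of n] by simp
  qed
qed

section \<open>A Lipschitz test function\<close>

definition bump :: "'a \<Rightarrow> 'a \<Rightarrow> real" where
  "bump x0 x = max 0 (1 - dist x0 x)"

lemma bump_measurable[measurable]: "bump x0 \<in> borel_measurable M"
proof -
  have "bump x0 \<in> borel_measurable borel"
    unfolding bump_def by (intro borel_measurable_continuous_onI continuous_intros)
  then show ?thesis by (simp add: measurable_cong_sets[OF sets_M refl])
qed

lemma bump_integrable: "integrable M (bump x0)"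
proof (rule Bochner_Integration.integrable_bound)
  show "integrable M (indicat_real (ball x0 1))"
    using ball_finite[of x0 1] by (simp add: integrable_indicator_iff)
qed (auto simp: bump_def indicator_def)

text \<open>The value 0 is excluded by the positive measure of the unit ball, where the bump is
  positive. A nonzero value would make the complement of the unit ball null, although larger balls
  have larger measure.\<close>

lemma bump_not_const: "\<not> (AE x in M. bump x0 x = c)"
proof
  assume AE: "AE x in M. bump x0 x = c"
  show False
  proof (cases "c = 0")
    case True
    have "AE x in M. x \<notin> ball x0 1" using AE by eventually_elim (auto simp: True bump_def)
    then have "emeasure M (ball x0 1) = 0" 
      by (intro AE_iff_measurable[THEN iffD1, rotated 2, of "\<lambda>x. x \<notin> ball x0 1"]) auto
    with ball_lower[of 1 x0] c1_pos show False by simp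
  next
    case False
    \<comment> \<open>At this radius the lower volume bound equals \<open>c2 + 1\<close>, which
      exceeds the upper bound \<open>c2\<close> for the unit ball.\<close>
    define R where "R = ((c2 + 1) / c1) powr (1 / dH)"
    have R: "R > 0" "c1 * R powr dH = c2 + 1"
      using c1_pos c2_pos dH_pos by (auto simp: R_def powr_powr)
    have "AE x in M. x \<in> ball x0 R \<longrightarrow> x \<in> ball x0 1"
      using AE by eventually_elim (use False in \<open>auto simp: bump_def max_def split: if_splits\<close>)
    then have "emeasure M (ball x0 R) \<le> emeasure M (ball x0 1)"
      by (rule emeasure_mono_AE) simp
    also have "\<dots> \<le> ennreal c2" using ball_upper[of 1 x0] by simp
    finally have "ennreal (c2 + 1) \<le> ennreal c2" using ball_lower[OF R(1), of x0] R(2) by simp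
    then show False using c2_pos by simp
  qed
qed

text \<open>The bump is 1-Lipschitz with values in [0, 1], so on \<open>near_diagonal r\<close> its
  differences are at most \<open>min 1 r\<close>, hence at most \<open>r powr b\<close> for
  \<open>b\<close> in [0, 1]. They vanish unless one of the points lies in the unit ball, which
  leaves an integral over a set of finite measure.\<close>

lemma bump_oscillation_le:
  assumes "0 \<le> b" "b \<le> 1"
  shows "\<exists>A\<ge>0. \<forall>r>0. oscillation (bump x0) r \<le> ennreal (A * r powr (dH + b))"
proof -
  have "oscillation (bump x0) r \<le> ennreal ((2 * c2 * c2) * r powr (dH + b))" if r: "r > 0" for r
  proof -
    have lip: "\<bar>bump x0 x - bump x0 y\<bar> \<le> r powr b * indicator (ball x0 1) x + r powr b * indicator (ball x0 1) y"
      if d: "dist x y < r" for x y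
    proof -
      have "\<bar>bump x0 x - bump x0 y\<bar> \<le> dist x y"
        using abs_dist_diff_le[of x0 x y] dist_triangle[of x0 x y] dist_triangle[of x0 y x]
        by (auto simp: bump_def max_def dist_commute abs_if)
      moreover have "\<bar>bump x0 x - bump x0 y\<bar> \<le> 1"
        using zero_le_dist[of x0 x] zero_le_dist[of x0 y] unfolding bump_def by linarith
      moreover have "bump x0 x - bump x0 y = 0" if "x \<notin> ball x0 1" "y \<notin> ball x0 1"
        using that by (auto simp: bump_def)
      moreover have "min 1 r \<le> r powr b"
      proof (cases "r \<le> 1")
        case True
        then show ?thesis using r assms powr_mono'[of b 1 r] by simp
      next
        case False
        then show ?thesis using assms by (simp add: ge_one_powr_ge_zero)
      qed
      moreover have "0 \<le> r powr b" by simp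
      ultimately show ?thesis using d by (auto simp: indicator_def)
    qed
    let ?g = "\<lambda>x. ennreal (r powr b) * indicator (ball x0 1) x"
    have "oscillation (bump x0) r \<le> (\<integral>\<^sup>+ z\<in>near_diagonal r. (?g (fst z) + ?g (snd z)) \<partial>(M \<Otimes>\<^sub>M M))"
      unfolding oscillation_def
    proof (intro nn_integral_mono)
      fix z
      have "?g x = ennreal (r powr b * indicator (ball x0 1) x)" for x
        by (auto simp: indicator_def)
      then show "ennreal \<bar>bump x0 (fst z) - bump x0 (snd z)\<bar> * indicator (near_diagonal r) z
        \<le> (?g (fst z) + ?g (snd z)) * indicator (near_diagonal r) z"
        using lip[of "fst z" "snd z"]
        by (auto simp: indicator_def near_diagonal_eq ennreal_plus[symmetric] simp del: ennreal_plus intro!: ennreal_leI)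
    qed
    also have "\<dots> \<le> ennreal (2 * c2 * r powr dH) * (\<integral>\<^sup>+ x. ?g x \<partial>M)"
      by (intro near_diagonal_integral_le r) measurable
    also have "\<dots> \<le> ennreal (2 * c2 * r powr dH) * (ennreal (r powr b) * ennreal c2)"
      using ball_upper[of 1 x0] by (intro mult_left_mono) (auto simp: nn_integral_cmult intro!: mult_left_mono)
    also have "\<dots> = ennreal ((2 * c2 * c2) * r powr (dH + b))"
      using c2_pos by (simp add: ennreal_mult[symmetric] powr_add mult_ac)
    finally show ?thesis .
  qed
  then show ?thesis using c2_pos by (intro exI[of _ "2 * c2 * c2"]) auto
qed

end

section \<open>The stable-like profile\<close>

lemma powr_scale:
  fixes t dW :: real
  assumes "t > 0" "dW > 0"
  shows "(t powr (1 / dW)) powr a = t powr (a / dW)"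
  using assms by (simp add: powr_powr)

text \<open>The shape shared by both heat kernel bounds, at distance \<open>s\<close> and time
  \<open>t\<close>. It changes regime at \<open>s = t powr (1 / dW)\<close>: below that scale it is
  of order \<open>t powr (- (dH / dW))\<close>, above it of order
  \<open>t * s powr (- dH - dW)\<close>.\<close>

definition profile :: "real \<Rightarrow> real \<Rightarrow> real \<Rightarrow> real \<Rightarrow> real \<Rightarrow> real" where
  "profile dH dW c s t =
     t powr (- (dH / dW)) * (1 + c * (s / t powr (1 / dW))) powr (- dH - dW)"

text \<open>Below the scale the base is at most \<open>1 + c\<close>, and the exponent is
  negative.\<close>

lemma profile_near:
  assumes "0 < dH" "0 < dW" "0 < c" "0 < t" "0 \<le> s" "s < t powr (1 / dW)"
  shows "(1 + c) powr (- dH - dW) * t powr (- (dH / dW)) \<le> profile dH dW c s t"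
proof -
  define u where "u = c * (s / t powr (1 / dW))"
  have "s / t powr (1 / dW) \<le> 1" "0 \<le> s / t powr (1 / dW)" using assms by auto
  then have u: "0 \<le> u" "u \<le> c" unfolding u_def
    using assms mult_left_le[of "s / t powr (1 / dW)" c] by (blast intro: mult_nonneg_nonneg less_imp_le)+
  have "(1 + c) powr (- dH - dW) \<le> (1 + u) powr (- dH - dW)"
    using assms u by (intro powr_mono2') auto
  then show ?thesis
    unfolding profile_def u_def[symmetric] by (subst mult.commute) (intro mult_left_mono, auto)
qed

text \<open>Without the summand 1 in the base, the exponents of \<open>t\<close> are
  \<open>- dH / dW\<close> and \<open>(dH + dW) / dW\<close>, which add up to 1. Hence the jump
  kernel appears with a factor linear in time.\<close>

lemma profile_tail_eq:
  fixes dH dW c s t :: real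
  assumes "0 < dW" "0 < c" "0 < t" "0 < s"
  shows "t powr (- (dH / dW)) * (c * (s / t powr (1 / dW))) powr (- dH - dW)
    = c powr (- dH - dW) * t * s powr (- dH - dW)"
proof -
  have m: "- ((- dH - dW) / dW) = (dH + dW) / dW"
    using assms by (simp add: field_simps)
  have "(c * (s / t powr (1 / dW))) powr (- dH - dW)
      = c powr (- dH - dW) * (s powr (- dH - dW) / t powr ((- dH - dW) / dW))"
    using assms by (simp only: powr_mult powr_divide powr_scale)
  also have "\<dots> = c powr (- dH - dW) * (s powr (- dH - dW) * t powr ((dH + dW) / dW))"
    using powr_minus[of t "(- dH - dW) / dW"] by (simp only: m divide_inverse[of _ "_ powr _"])
  finally have "t powr (- (dH / dW)) * (c * (s / t powr (1 / dW))) powr (- dH - dW)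
      = c powr (- dH - dW) * s powr (- dH - dW) * (t powr (- (dH / dW)) * t powr ((dH + dW) / dW))"
    by (simp add: mult_ac)
  also have "t powr (- (dH / dW)) * t powr ((dH + dW) / dW) = t"
    using assms by (simp add: powr_add[symmetric] add_divide_distrib)
  finally show ?thesis by (simp add: mult_ac)
qed

text \<open>Dropping the summand 1 shrinks the base, and the exponent is negative; so the bound
  holds at every positive distance.\<close>

lemma profile_far_upper:
  assumes "0 < dH" "0 < dW" "0 < c" "0 < t" "0 < s"
  shows "profile dH dW c s t \<le> c powr (- dH - dW) * t * s powr (- dH - dW)"
  unfolding profile_tail_eq[OF assms(2-5), symmetric] profile_def
  using assms by (intro mult_left_mono powr_mono2') auto

text \<open>Beyond the scale the summand 1 is at most the ratio \<open>s / t powr (1 / dW)\<close>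
  and is absorbed into the factor \<open>1 + c\<close>.\<close>

lemma profile_far_lower:
  assumes "0 < dH" "0 < dW" "0 < c" "0 < t" "t powr (1 / dW) \<le> s"
  shows "(1 + c) powr (- dH - dW) * t * s powr (- dH - dW) \<le> profile dH dW c s t"
proof -
  have s: "0 < s" using assms by (intro less_le_trans[of 0 "t powr (1 / dW)" s]) auto
  have "1 \<le> s / t powr (1 / dW)" using assms by simp
  then have le: "1 + c * (s / t powr (1 / dW)) \<le> (1 + c) * (s / t powr (1 / dW))"
    by (simp only: distrib_right)
  have gt: "0 < 1 + c * (s / t powr (1 / dW))"
    using assms s by (intro add_pos_nonneg) auto
  have "(1 + c) powr (- dH - dW) * t * s powr (- dH - dW)
      = t powr (- (dH / dW)) * ((1 + c) * (s / t powr (1 / dW))) powr (- dH - dW)"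
    using assms s by (subst profile_tail_eq) auto
  also have "\<dots> \<le> profile dH dW c s t"
    unfolding profile_def using assms gt le by (intro mult_left_mono powr_mono2') auto
  finally show ?thesis .
qed

text \<open>Take the least \<open>k\<close> whose dyadic radius exceeds \<open>s\<close>. If
  \<open>k = 0\<close>, the power is at most 1; otherwise minimality gives \<open>s\<close> at least
  half of that radius, hence the factor \<open>c / 2\<close>. The constant is a sum so as to cover
  both cases.\<close>

lemma profile_dyadic:
  assumes "0 < dH" "0 < dW" "0 < c" "0 < t" "0 \<le> s"
  shows "\<exists>k. s < 2 ^ k * t powr (1 / dW) \<and>
    profile dH dW c s t \<le> (1 + (c / 2) powr (- dH - dW)) * t powr (- (dH / dW)) * (2 powr (- dH - dW)) ^ k"
proof -
  let ?r = "t powr (1 / dW)" and ?e = "- dH - dW"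
  have r: "?r > 0" using assms by simp
  obtain n where "s / ?r < 2 ^ n"
    using real_arch_pow[of 2 "s / ?r"] by auto
  then have ex: "\<exists>n. s < 2 ^ n * ?r" using r by (auto simp: divide_simps)
  define k where "k = (LEAST n. s < 2 ^ n * ?r)"
  have k: "s < 2 ^ k * ?r" unfolding k_def using ex by (rule LeastI_ex)
  have "(1 + c * (s / ?r)) powr ?e \<le> (1 + (c / 2) powr ?e) * (2 powr ?e) ^ k"
  proof (cases k)
    case 0
    have "(1 + c * (s / ?r)) powr ?e \<le> 1 powr ?e"
      using assms by (intro powr_mono2') auto
    then show ?thesis by (simp add: 0 add_increasing2)
  next
    case (Suc j)
    then have "\<not> s < 2 ^ j * ?r" unfolding k_def by (intro not_less_Least) simp
    then have "2 ^ j \<le> s / ?r" using r by (simp add: divide_simps)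
    then have "c * 2 ^ j \<le> 1 + c * (s / ?r)"
      using assms by (intro order_trans[OF mult_left_mono[of "2 ^ j" "s / ?r" c]]) auto
    then have "(1 + c * (s / ?r)) powr ?e \<le> (c * 2 ^ j) powr ?e"
      using assms by (intro powr_mono2') auto
    also have "c * 2 ^ j = c / 2 * 2 ^ k" by (simp add: Suc)
    also have "(c / 2 * 2 ^ k) powr ?e = (c / 2) powr ?e * (2 powr ?e) ^ k"
    proof -
      have "(2 ^ k) powr ?e = (2 powr ?e) ^ k"
        by (simp only: powr_realpow[of 2 k, symmetric] powr_power) (simp add: powr_powr powr_power mult.commute)
      then show ?thesis using assms by (simp only: powr_mult)
    qed
    also have "\<dots> \<le> (1 + (c / 2) powr ?e) * (2 powr ?e) ^ k"
      by (intro mult_right_mono) auto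
    finally show ?thesis .
  qed
  then have "profile dH dW c s t \<le> (1 + (c / 2) powr ?e) * t powr (- (dH / dW)) * (2 powr ?e) ^ k"
    unfolding profile_def by (subst mult.assoc, subst mult.left_commute) (intro mult_left_mono, auto)
  with k show ?thesis by blast
qed

section \<open>Besov classes of stable-like kernels\<close>

text \<open>The exceptional null set in \<open>p_bounds\<close> may depend on \<open>t\<close>,
  since each estimate integrates at one fixed time.\<close>

locale stable_kernel = ahlfors_space +
  fixes p :: "real \<Rightarrow> 'a \<Rightarrow> 'a \<Rightarrow> real" and dW c3 c4 c5 c6 :: real
  assumes p_measurable: "\<And>t. 0 < t \<Longrightarrow> (\<lambda>(x, y). p t x y) \<in> borel_measurable (M \<Otimes>\<^sub>M M)"
    and pos: "0 < dW" "0 < c3" "0 < c4" "0 < c5" "0 < c6"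
    and p_bounds: "\<And>t. 0 < t \<Longrightarrow> AE z in M \<Otimes>\<^sub>M M.
      c5 * profile dH dW c6 (dist (fst z) (snd z)) t \<le> p t (fst z) (snd z) \<and>
      p t (fst z) (snd z) \<le> c3 * profile dH dW c4 (dist (fst z) (snd z)) t"
begin

section \<open>Heat kernel energy and jump density\<close>

definition energy :: "('a \<Rightarrow> real) \<Rightarrow> real \<Rightarrow> ennreal" where
  "energy f t = (\<integral>\<^sup>+ z. ennreal (\<bar>f (fst z) - f (snd z)\<bar> * p t (fst z) (snd z)) \<partial>(M \<Otimes>\<^sub>M M))"

text \<open>On the diagonal the numerator is 0, so the density is 0 there despite the vanishing
  denominator.\<close>

definition jump_density :: "('a \<Rightarrow> real) \<Rightarrow> 'a \<times> 'a \<Rightarrow> ennreal" where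
  "jump_density f z = ennreal (\<bar>f (fst z) - f (snd z)\<bar> / dist (fst z) (snd z) powr (dH + dW))"

lemma jump_density_measurable[measurable]:
  assumes [measurable]: "f \<in> borel_measurable M"
  shows "jump_density f \<in> borel_measurable (M \<Otimes>\<^sub>M M)"
proof -
  have [measurable]: "(\<lambda>z. dist (fst z) (snd z) powr (dH + dW)) \<in> borel_measurable (M \<Otimes>\<^sub>M M)"
    by (rule measurable_compose[OF dist_measurable]) measurable
  show ?thesis unfolding jump_density_def by measurable
qed

lemma kernel_measurable:
  assumes "0 < t"
  shows "(\<lambda>z. p t (fst z) (snd z)) \<in> borel_measurable (M \<Otimes>\<^sub>M M)"
  using p_measurable[OF assms] by (simp add: case_prod_unfold)

lemma energy_integrand_measurable:
  assumes [measurable]: "f \<in> borel_measurable M" and t: "0 < t"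
  shows "(\<lambda>z. ennreal (\<bar>f (fst z) - f (snd z)\<bar> * p t (fst z) (snd z))) \<in> borel_measurable (M \<Otimes>\<^sub>M M)"
proof -
  have "(\<lambda>z. \<bar>f (fst z) - f (snd z)\<bar>) \<in> borel_measurable (M \<Otimes>\<^sub>M M)" by measurable
  from borel_measurable_times[OF this kernel_measurable[OF t]] show ?thesis
    by (rule measurable_compose) simp
qed

lemma jump_density_eq:
  "jump_density f z = ennreal (\<bar>f (fst z) - f (snd z)\<bar> * dist (fst z) (snd z) powr (- dH - dW))"
  using powr_minus_divide[of "dist (fst z) (snd z)" "dH + dW"] by (simp add: jump_density_def)

lemma besov_seminorm_finite_iff:
  assumes f[measurable]: "f \<in> borel_measurable M"
  shows "besov_seminorm M p \<alpha> f < \<infinity> \<longleftrightarrow> (\<exists>A\<ge>0. \<forall>t>0. energy f t \<le> ennreal (A * t powr \<alpha>))"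
proof -
  have "(\<integral>\<^sup>+ y. \<integral>\<^sup>+ x. ennreal (\<bar>f x - f y\<bar> * p t x y) \<partial>M \<partial>M) = energy f t" if "t > 0" for t
  proof -
    show ?thesis unfolding energy_def
      using MM.nn_integral_snd[OF energy_integrand_measurable[OF f that]] by simp
  qed
  then have "besov_seminorm M p \<alpha> f = (SUP t\<in>{0<..}. ennreal (t powr - \<alpha>) * energy f t)"
    unfolding besov_seminorm_def by (intro SUP_cong) auto
  then show ?thesis by (simp only: SUP_powr_finite_iff)
qed

section \<open>Comparison of energy, oscillation and jump integral\<close>

text \<open>On \<open>near_diagonal\<close> at the radius \<open>t powr (1 / dW)\<close> the lower
  kernel bound is a constant times \<open>t powr (- (dH / dW))\<close>, by
  \<open>profile_near\<close>. The factor in front of the energy is the reciprocal of that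
  bound.\<close>

lemma oscillation_le_energy:
  assumes [measurable]: "f \<in> borel_measurable M" and t: "t > 0"
  shows "oscillation f (t powr (1 / dW))
    \<le> ennreal ((1 + c6) powr (dH + dW) / c5 * t powr (dH / dW)) * energy f t"
proof -
  let ?r = "t powr (1 / dW)" and ?K = "(1 + c6) powr (dH + dW) / c5 * t powr (dH / dW)"
  have "oscillation f ?r \<le> (\<integral>\<^sup>+ z. ennreal ?K * ennreal (\<bar>f (fst z) - f (snd z)\<bar> * p t (fst z) (snd z)) \<partial>(M \<Otimes>\<^sub>M M))"
    unfolding oscillation_def
  proof (rule nn_integral_mono_AE, use p_bounds[OF t] in eventually_elim)
    case (elim z)
    show ?case
    proof (cases "z \<in> near_diagonal ?r")
      case True
      then have "c5 * ((1 + c6) powr (- dH - dW) * t powr (- (dH / dW)))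
          \<le> c5 * profile dH dW c6 (dist (fst z) (snd z)) t"
        using pos dH_pos t by (intro mult_left_mono profile_near) (auto simp: near_diagonal_eq)
      with elim have le: "c5 * ((1 + c6) powr (- dH - dW) * t powr (- (dH / dW))) \<le> p t (fst z) (snd z)"
        by linarith
      have "?K * (c5 * ((1 + c6) powr (- dH - dW) * t powr (- (dH / dW))))
          = ((1 + c6) powr (dH + dW) * (1 + c6) powr (- dH - dW)) * (t powr (dH / dW) * t powr (- (dH / dW)))"
        using pos by (simp add: field_simps)
      also have "\<dots> = 1" using pos t by (simp add: powr_add[symmetric])
      finally have "1 \<le> ?K * p t (fst z) (snd z)"
        using mult_left_mono[OF le, of ?K] pos by simp
      then have "\<bar>f (fst z) - f (snd z)\<bar> \<le> \<bar>f (fst z) - f (snd z)\<bar> * (?K * p t (fst z) (snd z))"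
        using mult_left_mono[of 1 "?K * p t (fst z) (snd z)" "\<bar>f (fst z) - f (snd z)\<bar>"] by simp
      then have "ennreal \<bar>f (fst z) - f (snd z)\<bar>
          \<le> ennreal (?K * (\<bar>f (fst z) - f (snd z)\<bar> * p t (fst z) (snd z)))"
        by (intro ennreal_leI) (simp only: mult.left_commute)
      also have "\<dots> = ennreal ?K * ennreal (\<bar>f (fst z) - f (snd z)\<bar> * p t (fst z) (snd z))"
        using pos by (intro ennreal_mult') simp
      finally show ?thesis using True by simp
    qed simp
  qed
  also have "\<dots> = ennreal ?K * energy f t"
    using energy_integrand_measurable[OF assms(1) t] unfolding energy_def by (rule nn_integral_cmult)
  finally show ?thesis .
qed


text \<open>The dyadic bound dominates the kernel by a series of weighted indicators of
  \<open>near_diagonal\<close> at the radii \<open>2 ^ k * t powr (1 / dW)\<close>. Integrating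
  termwise gives a geometric series of ratio \<open>2 powr (b - dW)\<close>.\<close>

lemma energy_le_if_oscillation_le:
  assumes f[measurable]: "f \<in> borel_measurable M" and b: "b < dW" and A: "A \<ge> 0"
    and osc: "\<And>r. r > 0 \<Longrightarrow> oscillation f r \<le> ennreal (A * r powr (dH + b))"
  shows "\<exists>B\<ge>0. \<forall>t>0. energy f t \<le> ennreal (B * t powr (b / dW))"
proof -
  define C where "C = c3 * (1 + (c4 / 2) powr (- dH - dW))"
  define w where "w = 2 powr (- dH - dW)"
  define B where "B = C * A * (1 / (1 - 2 powr (b - dW)))"
  have C: "C \<ge> 0" using pos by (simp add: C_def)
  have w: "w \<ge> 0" by (simp add: w_def)
  \<comment> \<open>Here \<open>b < dW\<close> makes the geometric series converge; with
    \<open>b\<close> = \<alpha> \<open>* dW\<close> this is the condition \<alpha>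
    \<open>< 1\<close>.\<close>
  have q: "0 \<le> 2 powr (b - dW)" "2 powr (b - dW) < 1"
    using b by (auto simp: powr_less_one)
  have "energy f t \<le> ennreal (B * t powr (b / dW))" if t: "t > 0" for t
  proof -
    let ?r = "t powr (1 / dW)" and ?m = "\<lambda>k. C * t powr (- (dH / dW)) * w ^ k"
    have r: "?r > 0" using t by simp
    let ?g = "\<lambda>k z. ennreal (?m k) * (ennreal \<bar>f (fst z) - f (snd z)\<bar> * indicator (near_diagonal (2 ^ k * ?r)) z)"
    have "energy f t \<le> (\<integral>\<^sup>+ z. (\<Sum>k. ?g k z) \<partial>(M \<Otimes>\<^sub>M M))"
      unfolding energy_def
    proof (rule nn_integral_mono_AE, use p_bounds[OF t] in eventually_elim)
      case (elim z)
      obtain k where k: "dist (fst z) (snd z) < 2 ^ k * ?r"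
        "profile dH dW c4 (dist (fst z) (snd z)) t
          \<le> (1 + (c4 / 2) powr (- dH - dW)) * t powr (- (dH / dW)) * (2 powr (- dH - dW)) ^ k"
        using profile_dyadic[OF dH_pos pos(1) pos(3) t zero_le_dist] by blast
      have "c3 * profile dH dW c4 (dist (fst z) (snd z)) t \<le> ?m k"
        using mult_left_mono[OF k(2), of c3] pos unfolding C_def w_def by (simp only: mult.assoc less_imp_le)
      with elim have "p t (fst z) (snd z) \<le> ?m k" by linarith
      then have "\<bar>f (fst z) - f (snd z)\<bar> * p t (fst z) (snd z) \<le> ?m k * \<bar>f (fst z) - f (snd z)\<bar>"
        by (subst mult.commute) (intro mult_right_mono, auto)
      then have "ennreal (\<bar>f (fst z) - f (snd z)\<bar> * p t (fst z) (snd z)) \<le> ?g k z"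
        using k(1) C w by (simp add: near_diagonal_eq ennreal_mult'[symmetric] ennreal_leI)
      \<comment> \<open>The terms are nonnegative, so the single term selected by
        \<open>profile_dyadic\<close> is at most the whole sum.\<close>
      also have "\<dots> \<le> (\<Sum>k. ?g k z)"
        using sum_le_suminf[of "\<lambda>k. ?g k z" "{k}"] by simp
      finally show ?case .
    qed
    also have "\<dots> = (\<Sum>k. \<integral>\<^sup>+ z. ?g k z \<partial>(M \<Otimes>\<^sub>M M))"
      by (rule nn_integral_suminf) measurable
    also have "\<dots> = (\<Sum>k. ennreal (?m k) * oscillation f (2 ^ k * ?r))"
      unfolding oscillation_def by (intro suminf_cong nn_integral_cmult) measurable
    also have "\<dots> \<le> (\<Sum>k. ennreal (C * A * t powr (b / dW) * (2 powr (b - dW)) ^ k))"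
    proof (intro suminf_le summableI)
      fix k :: nat
      have "ennreal (?m k) * oscillation f (2 ^ k * ?r)
          \<le> ennreal (?m k) * ennreal (A * (2 ^ k * ?r) powr (dH + b))"
        using r by (intro mult_left_mono osc) auto
      also have "\<dots> = ennreal (?m k * (A * (2 ^ k * ?r) powr (dH + b)))"
        using A C w by (intro ennreal_mult[symmetric]) auto
      also have "?m k * (A * (2 ^ k * ?r) powr (dH + b))
          = C * A * (t powr (- (dH / dW)) * t powr ((dH + b) / dW)) * (w ^ k * (2 ^ k) powr (dH + b))"
        using t pos by (simp only: powr_mult powr_scale mult_ac)
      also have "t powr (- (dH / dW)) * t powr ((dH + b) / dW) = t powr (b / dW)"
        by (simp add: powr_add[symmetric] add_divide_distrib)
      \<comment> \<open>The decay exponent \<open>dH + dW\<close> of the kernel meets the growth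
        exponent \<open>dH + b\<close> of the oscillation; \<open>dH\<close> cancels.\<close>
      also have "w ^ k * (2 ^ k) powr (dH + b) = (2 powr (b - dW)) ^ k"
        unfolding w_def powr_realpow[of 2 k, symmetric, simplified] powr_power
        by (simp add: powr_powr powr_power powr_add[symmetric] algebra_simps)
      finally show "ennreal (?m k) * oscillation f (2 ^ k * ?r)
          \<le> ennreal (C * A * t powr (b / dW) * (2 powr (b - dW)) ^ k)" .
    qed
    also have "\<dots> = ennreal (C * A * t powr (b / dW) * (1 / (1 - 2 powr (b - dW))))"
      using A C q by (intro suminf_ennreal_eq sums_mult geometric_sums) auto
    finally show ?thesis by (simp add: B_def mult_ac)
  qed
  moreover have "B \<ge> 0" using A C q by (simp add: B_def)
  ultimately show ?thesis by blast
qed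

text \<open>At time \<open>r powr dW\<close> the scale of the kernel is exactly \<open>r\<close>, so
  off \<open>near_diagonal r\<close> the lower bound of \<open>profile_far_lower\<close> applies.
  The factor \<open>r powr - dW\<close> divides by that time.\<close>

lemma jump_tail_le_energy:
  assumes [measurable]: "f \<in> borel_measurable M" and r: "r > 0"
  shows "(\<integral>\<^sup>+ z\<in>- near_diagonal r. jump_density f z \<partial>(M \<Otimes>\<^sub>M M))
    \<le> ennreal ((1 + c6) powr (dH + dW) / c5 * r powr - dW) * energy f (r powr dW)"
proof -
  let ?t = "r powr dW" and ?K = "(1 + c6) powr (dH + dW) / c5 * r powr - dW"
  have t: "?t > 0" using r by simp
  have tr: "?t powr (1 / dW) = r" using r pos by (simp add: powr_powr)
  have "(\<integral>\<^sup>+ z\<in>- near_diagonal r. jump_density f z \<partial>(M \<Otimes>\<^sub>M M))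
      \<le> (\<integral>\<^sup>+ z. ennreal ?K * ennreal (\<bar>f (fst z) - f (snd z)\<bar> * p ?t (fst z) (snd z)) \<partial>(M \<Otimes>\<^sub>M M))"
  proof (rule nn_integral_mono_AE, use p_bounds[OF t] in eventually_elim)
    case (elim z)
    let ?s = "dist (fst z) (snd z)"
    show ?case
    proof (cases "z \<in> near_diagonal r")
      case False
      then have "c5 * ((1 + c6) powr (- dH - dW) * ?t * ?s powr (- dH - dW)) \<le> c5 * profile dH dW c6 ?s ?t"
        using pos dH_pos t tr by (intro mult_left_mono profile_far_lower) (auto simp: near_diagonal_eq)
      with elim have le: "c5 * ((1 + c6) powr (- dH - dW) * ?t * ?s powr (- dH - dW)) \<le> p ?t (fst z) (snd z)"
        by linarith
      have "?K * (c5 * ((1 + c6) powr (- dH - dW) * ?t * ?s powr (- dH - dW)))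
          = ((1 + c6) powr (dH + dW) * (1 + c6) powr (- dH - dW)) * (r powr - dW * r powr dW) * ?s powr (- dH - dW)"
        using pos by (simp add: field_simps)
      also have "\<dots> = ?s powr (- dH - dW)" using pos r by (simp add: powr_add[symmetric])
      finally have "?K * (c5 * ((1 + c6) powr (- dH - dW) * ?t * ?s powr (- dH - dW))) = ?s powr (- dH - dW)" .
      moreover have "?K \<ge> 0" using pos by simp
      ultimately have "?s powr (- dH - dW) \<le> ?K * p ?t (fst z) (snd z)"
        using mult_left_mono[OF le, of ?K] by (simp only:)
      then have "\<bar>f (fst z) - f (snd z)\<bar> * ?s powr (- dH - dW) \<le> \<bar>f (fst z) - f (snd z)\<bar> * (?K * p ?t (fst z) (snd z))"
        by (intro mult_left_mono) auto
      then have "jump_density f z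
          \<le> ennreal (?K * (\<bar>f (fst z) - f (snd z)\<bar> * p ?t (fst z) (snd z)))"
        unfolding jump_density_eq by (intro ennreal_leI) (simp only: mult.left_commute)
      also have "\<dots> = ennreal ?K * ennreal (\<bar>f (fst z) - f (snd z)\<bar> * p ?t (fst z) (snd z))"
        using pos by (intro ennreal_mult') simp
      finally show ?thesis using False by simp
    qed simp
  qed
  also have "\<dots> = ennreal ?K * energy f ?t"
    using energy_integrand_measurable[OF assms(1) t] unfolding energy_def by (rule nn_integral_cmult)
  finally show ?thesis .
qed

text \<open>Off the diagonal \<open>profile_far_upper\<close> applies at every time; on the diagonal
  the energy integrand vanishes.\<close>

lemma energy_le_jump:
  assumes [measurable]: "f \<in> borel_measurable M" and t: "t > 0"
  shows "energy f t \<le> ennreal (c3 * c4 powr (- dH - dW) * t) * (\<integral>\<^sup>+ z. jump_density f z \<partial>(M \<Otimes>\<^sub>M M))"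
proof -
  have "energy f t \<le> (\<integral>\<^sup>+ z. ennreal (c3 * c4 powr (- dH - dW) * t) * jump_density f z \<partial>(M \<Otimes>\<^sub>M M))"
    unfolding energy_def
  proof (rule nn_integral_mono_AE, use p_bounds[OF t] in eventually_elim)
    case (elim z)
    let ?s = "dist (fst z) (snd z)"
    show ?case
    proof (cases "fst z = snd z")
      case False
      then have "c3 * profile dH dW c4 ?s t \<le> c3 * (c4 powr (- dH - dW) * t * ?s powr (- dH - dW))"
        using pos dH_pos t by (intro mult_left_mono profile_far_upper) auto
      with elim have "p t (fst z) (snd z) \<le> c3 * (c4 powr (- dH - dW) * t * ?s powr (- dH - dW))"
        by linarith
      then have "\<bar>f (fst z) - f (snd z)\<bar> * p t (fst z) (snd z)
          \<le> \<bar>f (fst z) - f (snd z)\<bar> * (c3 * (c4 powr (- dH - dW) * t * ?s powr (- dH - dW)))"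
        by (intro mult_left_mono) auto
      then show ?thesis using pos t
        by (simp add: jump_density_eq ennreal_mult'[symmetric] mult_ac ennreal_leI)
    qed simp
  qed
  also have "\<dots> = ennreal (c3 * c4 powr (- dH - dW) * t) * (\<integral>\<^sup>+ z. jump_density f z \<partial>(M \<Otimes>\<^sub>M M))"
    by (rule nn_integral_cmult) measurable
  finally show ?thesis .
qed

text \<open>The tail estimate at radius \<open>1 / Suc n\<close> bounds the truncated jump integral
  by a constant times the \<open>n\<close>-th term of the sequence in \<open>lim\<close>; Fatou's
  lemma then removes the truncation. The limit \<open>L\<close> is 1 when \<alpha> is 1, and 0 when
  \<alpha> exceeds 1.\<close>

lemma jump_le_if_energy_le:
  assumes f[measurable]: "f \<in> borel_measurable M" and A: "A \<ge> 0"
    and en: "\<And>t. t > 0 \<Longrightarrow> energy f t \<le> ennreal (A * t powr \<alpha>)"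
    and lim: "(\<lambda>n. real (Suc n) powr (dW * (1 - \<alpha>))) \<longlonglongrightarrow> L"
  shows "(\<integral>\<^sup>+ z. jump_density f z \<partial>(M \<Otimes>\<^sub>M M)) \<le> ennreal ((1 + c6) powr (dH + dW) / c5 * A * L)"
proof -
  let ?K = "(1 + c6) powr (dH + dW) / c5"
  let ?u = "\<lambda>n z. jump_density f z * indicator (- near_diagonal (1 / real (Suc n))) z"
  \<comment> \<open>Off the diagonal the truncated densities are eventually equal to the full one;
    on the diagonal all of them are 0.\<close>
  have "jump_density f z = liminf (\<lambda>n. ?u n z)" for z
  proof (cases "fst z = snd z")
    case True
    then show ?thesis by (simp add: jump_density_def Liminf_const)
  next
    case False
    then obtain N where N: "1 / real (Suc N) < dist (fst z) (snd z)"
      using nat_approx_posE[of "dist (fst z) (snd z)"] by auto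
    have "?u n z = jump_density f z" if "n \<ge> N" for n
    proof -
      have "1 / real (Suc n) \<le> 1 / real (Suc N)" using that by (simp add: frac_le)
      then show ?thesis using N by (simp add: near_diagonal_eq)
    qed
    then have "(\<lambda>n. ?u n z) \<longlonglongrightarrow> jump_density f z"
      by (intro tendsto_eventually eventually_sequentiallyI)
    then show ?thesis by (simp add: lim_imp_Liminf)
  qed
  then have "(\<integral>\<^sup>+ z. jump_density f z \<partial>(M \<Otimes>\<^sub>M M)) = (\<integral>\<^sup>+ z. liminf (\<lambda>n. ?u n z) \<partial>(M \<Otimes>\<^sub>M M))"
    by simp
  also have "\<dots> \<le> liminf (\<lambda>n. \<integral>\<^sup>+ z. ?u n z \<partial>(M \<Otimes>\<^sub>M M))"
    by (rule nn_integral_liminf) measurable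
  also have "\<dots> \<le> liminf (\<lambda>n. ennreal (?K * A * real (Suc n) powr (dW * (1 - \<alpha>))))"
  proof (intro Liminf_mono always_eventually allI)
    fix n
    let ?r = "1 / real (Suc n)"
    have r: "?r > 0" by simp
    have "(\<integral>\<^sup>+ z. ?u n z \<partial>(M \<Otimes>\<^sub>M M)) \<le> ennreal (?K * ?r powr - dW) * energy f (?r powr dW)"
      by (rule jump_tail_le_energy) simp_all
    also have "\<dots> \<le> ennreal (?K * ?r powr - dW) * ennreal (A * (?r powr dW) powr \<alpha>)"
      by (intro mult_left_mono en) simp_all
    also have "\<dots> = ennreal (?K * A * (?r powr - dW * ?r powr (dW * \<alpha>)))"
      using pos A by (simp add: ennreal_mult'[symmetric] powr_powr mult_ac)
    also have "?r powr - dW * ?r powr (dW * \<alpha>) = ?r powr - (dW * (1 - \<alpha>))"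
      by (simp add: powr_add[symmetric] algebra_simps)
    also have "\<dots> = real (Suc n) powr (dW * (1 - \<alpha>))"
      unfolding powr_minus by (simp add: powr_divide)
    finally show "(\<integral>\<^sup>+ z. ?u n z \<partial>(M \<Otimes>\<^sub>M M)) \<le> ennreal (?K * A * real (Suc n) powr (dW * (1 - \<alpha>)))" .
  qed
  also have "\<dots> = ennreal (?K * A * L)"
    by (intro lim_imp_Liminf tendsto_ennrealI tendsto_mult tendsto_const lim) simp
  finally show ?thesis .
qed

section \<open>Descriptions of the Besov classes\<close>

text \<open>The substitution \<open>t = r powr dW\<close> matches the two comparison estimates. The
  condition \<alpha> \<open>< 1\<close> enters in the direction from oscillation to seminorm,
  through the convergence of the dyadic series.\<close>

lemma besov_seminorm_finite_iff_oscillation: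
  assumes f: "integrable M f" and \<alpha>: "\<alpha> < 1"
  shows "besov_seminorm M p \<alpha> f < \<infinity> \<longleftrightarrow>
    (\<exists>A\<ge>0. \<forall>r>0. oscillation f r \<le> ennreal (A * r powr (dH + \<alpha> * dW)))"
proof -
  have fm[measurable]: "f \<in> borel_measurable M" using f by simp
  show ?thesis
    unfolding besov_seminorm_finite_iff[OF fm]
  proof
    assume "\<exists>A\<ge>0. \<forall>t>0. energy f t \<le> ennreal (A * t powr \<alpha>)"
    then obtain A where A: "A \<ge> 0" "\<And>t. t > 0 \<Longrightarrow> energy f t \<le> ennreal (A * t powr \<alpha>)" by blast
    let ?K = "(1 + c6) powr (dH + dW) / c5"
    have "oscillation f r \<le> ennreal (?K * A * r powr (dH + \<alpha> * dW))" if r: "r > 0" for r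
    proof -
      let ?t = "r powr dW"
      have "oscillation f r \<le> ennreal (?K * ?t powr (dH / dW)) * energy f ?t"
        using oscillation_le_energy[OF fm, of ?t] r pos by (simp add: powr_powr)
      also have "\<dots> \<le> ennreal (?K * ?t powr (dH / dW)) * ennreal (A * ?t powr \<alpha>)"
        using r by (intro mult_left_mono A(2)) auto
      also have "\<dots> = ennreal (?K * A * r powr (dH + \<alpha> * dW))"
        using pos A(1) by (simp add: ennreal_mult'[symmetric] powr_powr powr_add mult_ac)
      finally show ?thesis .
    qed
    then show "\<exists>A\<ge>0. \<forall>r>0. oscillation f r \<le> ennreal (A * r powr (dH + \<alpha> * dW))"
      using A pos by (intro exI[of _ "?K * A"]) auto
  next
    assume "\<exists>A\<ge>0. \<forall>r>0. oscillation f r \<le> ennreal (A * r powr (dH + \<alpha> * dW))"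
    then obtain A where A: "A \<ge> 0" "\<And>r. r > 0 \<Longrightarrow> oscillation f r \<le> ennreal (A * r powr (dH + \<alpha> * dW))" by blast
    show "\<exists>A\<ge>0. \<forall>t>0. energy f t \<le> ennreal (A * t powr \<alpha>)"
      using energy_le_if_oscillation_le[OF fm _ A] pos \<alpha> by simp
  qed
qed

text \<open>At exponent 1 the powers of the radius in the tail estimate cancel, so the truncated
  jump integrals are uniformly bounded. The converse is the time-linear bound
  \<open>energy_le_jump\<close>.\<close>

lemma besov_seminorm_1_finite_iff:
  assumes fm[measurable]: "f \<in> borel_measurable M"
  shows "besov_seminorm M p 1 f < \<infinity> \<longleftrightarrow> (\<integral>\<^sup>+ z. jump_density f z \<partial>(M \<Otimes>\<^sub>M M)) < \<infinity>"
  unfolding besov_seminorm_finite_iff[OF fm]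
proof
  assume "\<exists>A\<ge>0. \<forall>t>0. energy f t \<le> ennreal (A * t powr 1)"
  then obtain A where "A \<ge> 0" "\<And>t. t > 0 \<Longrightarrow> energy f t \<le> ennreal (A * t powr 1)" by blast
  from jump_le_if_energy_le[OF fm this, of 1]
  show "(\<integral>\<^sup>+ z. jump_density f z \<partial>(M \<Otimes>\<^sub>M M)) < \<infinity>"
    by (auto intro: le_less_trans)
next
  let ?I = "\<integral>\<^sup>+ z. jump_density f z \<partial>(M \<Otimes>\<^sub>M M)"
  assume fin: "?I < \<infinity>"
  then have "energy f t \<le> ennreal ((c3 * c4 powr (- dH - dW) * enn2real ?I) * t powr 1)" if "t > 0" for t
    using energy_le_jump[OF fm that] that pos
    by (cases ?I) (auto simp: ennreal_mult'[symmetric] mult_ac)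
  then show "\<exists>A\<ge>0. \<forall>t>0. energy f t \<le> ennreal (A * t powr 1)"
    using pos by (intro exI[of _ "c3 * c4 powr (- dH - dW) * enn2real ?I"]) auto
qed

section \<open>Triviality and the critical exponent\<close>

text \<open>The exponent \<open>dW * (1 -\<close> \<alpha>\<open>)\<close> is negative, so the
  bounds on the truncated jump integrals tend to 0 and the jump integral vanishes.\<close>

lemma besov_trivial_above_1:
  assumes "1 < \<alpha>"
  shows "trivial_space M (besov M p \<alpha>)"
  unfolding trivial_space_def
proof
  fix f assume "f \<in> besov M p \<alpha>"
  then have fm[measurable]: "f \<in> borel_measurable M" and "besov_seminorm M p \<alpha> f < \<infinity>"
    by (auto simp: besov_def L1_space_def)
  then obtain A where A: "A \<ge> 0" "\<And>t. t > 0 \<Longrightarrow> energy f t \<le> ennreal (A * t powr \<alpha>)"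
    using besov_seminorm_finite_iff by blast
  have "(\<lambda>n. real (Suc n) powr (dW * (1 - \<alpha>))) \<longlonglongrightarrow> 0"
    using assms pos
    by (intro tendsto_neg_powr filterlim_compose[OF filterlim_real_sequentially filterlim_Suc]) (simp add: mult_pos_neg)
  from jump_le_if_energy_le[OF fm A this]
  have "(\<integral>\<^sup>+ z. jump_density f z \<partial>(M \<Otimes>\<^sub>M M)) = 0" by simp
  then have "AE z in M \<Otimes>\<^sub>M M. jump_density f z = 0"
    by (subst nn_integral_0_iff_AE[symmetric]) auto
  then have "AE z in M \<Otimes>\<^sub>M M. f (fst z) = f (snd z)"
    \<comment> \<open>Off the diagonal the weight in the density is positive, so the difference must
      vanish; on the diagonal the equality is trivial.\<close>
    by eventually_elim (auto simp: jump_density_eq ennreal_eq_0_iff mult_le_0_iff)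
  then show "\<exists>c. AE x in M. f x = c" by (rule AE_constI)
qed

text \<open>The bump is a nonconstant element: its oscillation bound with \<open>b\<close> =
  \<alpha> \<open>* dW\<close> is the required one.\<close>

lemma besov_not_trivial:
  assumes "0 < \<alpha>" "\<alpha> < 1" "\<alpha> * dW \<le> 1"
  shows "\<not> trivial_space M (besov M p \<alpha>)"
proof -
  fix x0 :: 'a
  have "besov_seminorm M p \<alpha> (bump x0) < \<infinity>"
    using bump_oscillation_le[of "\<alpha> * dW" x0] assms pos
    by (subst besov_seminorm_finite_iff_oscillation[OF bump_integrable]) auto
  then have "bump x0 \<in> besov M p \<alpha>"
    using bump_integrable by (simp add: besov_def L1_space_def)
  then show ?thesis using bump_not_const unfolding trivial_space_def by blast
qed

text \<open>Below \<open>a\<close> the bump excludes triviality. Triviality on an interval to the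
  right of \<open>a\<close> already brings the infimum down to \<open>a\<close>; the bound
  \<open>b\<close> allows for a triviality result restricted to \<alpha> \<open>< 1\<close>.\<close>

lemma critical_exponent_eqI:
  assumes "0 < a" "a \<le> 1" "a * dW \<le> 1" "a < b"
    and triv: "\<And>\<alpha>. a < \<alpha> \<Longrightarrow> \<alpha> < b \<Longrightarrow> trivial_space M (besov M p \<alpha>)"
  shows "besov_critical_exponent M p = ereal a"
proof (rule antisym)
  show "ereal a \<le> besov_critical_exponent M p"
    unfolding besov_critical_exponent_def
  proof (rule INF_greatest)
    fix \<alpha> assume \<alpha>: "\<alpha> \<in> {\<alpha>. 0 < \<alpha> \<and> trivial_space M (besov M p \<alpha>)}"
    have "\<alpha> * dW \<le> 1" if "\<alpha> < a"
      using that assms(3) pos mult_right_mono[of \<alpha> a dW] by linarith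
    then show "ereal a \<le> ereal \<alpha>"
      using besov_not_trivial[of \<alpha>] \<alpha> assms(2) by fastforce
  qed
  show "besov_critical_exponent M p \<le> ereal a"
  proof (rule dense_ge_bounded)
    show "ereal a < ereal b" using assms by simp
    fix w :: ereal assume w: "ereal a < w" "w < ereal b"
    then obtain \<alpha> where \<alpha>: "w = ereal \<alpha>" by (cases w) auto
    show "besov_critical_exponent M p \<le> w"
      unfolding besov_critical_exponent_def \<alpha>
      using w assms triv[of \<alpha>] by (intro INF_lower) (simp add: \<alpha>)
  qed
qed

lemma korevaar_schoen_eq: "korevaar_schoen M dH f r = ennreal (r powr - (dH + 1)) * oscillation f r"
  unfolding korevaar_schoen_def oscillation_def powr_minus_divide ..

text \<open>The quotient \<open>korevaar_schoen\<close> is bounded by a multiple of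
  \<open>r powr (\<close>\<alpha> \<open>* dW - 1)\<close>, with positive exponent, so its limsup at
  0 is 0. The assumed inequality then annihilates its supremum, once that supremum is known to be
  finite.\<close>

lemma besov_trivial_if_limsup:
  assumes "1 < \<alpha> * dW" "\<alpha> < 1"
    and hyp: "\<And>f. f \<in> L1_space M \<Longrightarrow> (SUP r\<in>{0<..}. korevaar_schoen M dH f r) < \<infinity> \<Longrightarrow>
      (SUP r\<in>{0<..}. korevaar_schoen M dH f r)
        \<le> ennreal C * Limsup (at_right 0) (\<lambda>r. korevaar_schoen M dH f r)"
  shows "trivial_space M (besov M p \<alpha>)"
  unfolding trivial_space_def
proof
  fix f assume "f \<in> besov M p \<alpha>"
  then have f: "integrable M f" and "besov_seminorm M p \<alpha> f < \<infinity>"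
    by (auto simp: besov_def L1_space_def)
  then obtain A where A: "A \<ge> 0" "\<And>r. r > 0 \<Longrightarrow> oscillation f r \<le> ennreal (A * r powr (dH + \<alpha> * dW))"
    using besov_seminorm_finite_iff_oscillation assms(2) by blast
  obtain A' where A': "A' \<ge> 0" "\<And>r. r > 0 \<Longrightarrow> oscillation f r \<le> ennreal (A' * r powr dH)"
    using oscillation_le[OF f] by blast
  \<comment> \<open>Finiteness of the supremum needs both regimes: the Besov bound for
    \<open>r\<close> at most 1, the crude bound by the integral of the absolute value for
    \<open>r > 1\<close>. The sum \<open>A + A'\<close> serves for both.\<close>
  have "oscillation f r \<le> ennreal ((A + A') * r powr (dH + 1))" if r: "r > 0" for r
  proof (cases "r \<le> 1")
    case True
    then have "r powr (dH + \<alpha> * dW) \<le> r powr (dH + 1)"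
      using r assms by (intro powr_mono') auto
    then have "A * r powr (dH + \<alpha> * dW) \<le> (A + A') * r powr (dH + 1)"
      using A A' by (intro mult_mono) auto
    with A(2)[OF r] show ?thesis by (blast intro: order_trans ennreal_leI)
  next
    case False
    then have "r powr dH \<le> r powr (dH + 1)" by (intro powr_mono) auto
    then have "A' * r powr dH \<le> (A + A') * r powr (dH + 1)"
      using A A' by (intro mult_mono) auto
    with A'(2)[OF r] show ?thesis by (blast intro: order_trans ennreal_leI)
  qed
  then have fin: "(SUP r\<in>{0<..}. korevaar_schoen M dH f r) < \<infinity>"
    unfolding korevaar_schoen_eq SUP_powr_finite_iff using A A' by (intro exI[of _ "A + A'"]) auto
  have "((\<lambda>r. ennreal (A * r powr (\<alpha> * dW - 1))) \<longlongrightarrow> ennreal (A * 0)) (at_right 0)"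
  proof (intro tendsto_ennrealI tendsto_mult tendsto_const)
    show "((\<lambda>r. r powr (\<alpha> * dW - 1)) \<longlongrightarrow> 0) (at_right 0)"
      using assms by (intro tendsto_zero_powrI[where b = "\<alpha> * dW - 1"] tendsto_ident_at tendsto_const
          eventually_mono[OF eventually_at_right_less]) auto
  qed
  moreover have "eventually (\<lambda>r. korevaar_schoen M dH f r \<le> ennreal (A * r powr (\<alpha> * dW - 1))) (at_right 0)"
    using eventually_at_right_less
  proof eventually_elim
    case (elim r)
    have "korevaar_schoen M dH f r \<le> ennreal (r powr - (dH + 1)) * ennreal (A * r powr (dH + \<alpha> * dW))"
      unfolding korevaar_schoen_eq by (intro mult_left_mono A(2) elim) simp
    also have "\<dots> = ennreal (A * (r powr - (dH + 1) * r powr (dH + \<alpha> * dW)))"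
      using A(1) by (simp add: ennreal_mult'[symmetric] mult_ac)
    also have "r powr - (dH + 1) * r powr (dH + \<alpha> * dW) = r powr (\<alpha> * dW - 1)"
      by (simp add: powr_add[symmetric])
    finally show ?case .
  qed
  ultimately have "((\<lambda>r. korevaar_schoen M dH f r) \<longlongrightarrow> 0) (at_right 0)"
    using tendsto_sandwich[of "\<lambda>_. 0" "\<lambda>r. korevaar_schoen M dH f r" "at_right 0"
        "\<lambda>r. ennreal (A * r powr (\<alpha> * dW - 1))" 0] by simp
  then have "Limsup (at_right 0) (\<lambda>r. korevaar_schoen M dH f r) = 0"
    by (intro lim_imp_Limsup) auto
  with hyp[OF _ fin] f have "(SUP r\<in>{0<..}. korevaar_schoen M dH f r) = 0"
    by (simp add: L1_space_def)
  then have "korevaar_schoen M dH f r = 0" if "r > 0" for r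
    using SUP_upper[of r "{0<..}" "korevaar_schoen M dH f"] that by simp
  then have "oscillation f r = 0" if "r > 0" for r
    using that unfolding korevaar_schoen_eq by (fastforce simp: ennreal_eq_0_iff powr_minus)
  then show "\<exists>c. AE x in M. f x = c"
    using f by (intro AE_const_if_oscillation_0) auto
qed

end

section \<open>Critical exponent and critical Besov classes\<close>

theorem theorem0p21:
  fixes M :: "'a::metric_space measure"
    and E :: "('a \<Rightarrow> real) \<Rightarrow> ('a \<Rightarrow> real) \<Rightarrow> real"
    and F :: "('a \<Rightarrow> real) set"
    and P :: "real \<Rightarrow> ('a \<Rightarrow> real) \<Rightarrow> ('a \<Rightarrow> real)"
    and p :: "real \<Rightarrow> 'a \<Rightarrow> 'a \<Rightarrow> real"
    and d\<^sub>H d\<^sub>W c\<^sub>3 c\<^sub>4 c\<^sub>5 c\<^sub>6 C :: real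
  assumes "metric_measure_space M"
    and "ahlfors_regular M d\<^sub>H"
    and "dirichlet_form M E F"
    and "regular_form M E F"
    and "\<not> local_form M E F"
    and "semigroup_of_form M E F P"
    and "conservative M P"
    and "heat_kernel M P p"
    and "0 < c\<^sub>3" "0 < c\<^sub>4" "0 < c\<^sub>5" "0 < c\<^sub>6"
    and "0 < d\<^sub>W" "d\<^sub>W \<le> d\<^sub>H + 1"
    and "AE (x, y) in M \<Otimes>\<^sub>M M. \<forall>t>0.
           c\<^sub>5 * t powr (- (d\<^sub>H / d\<^sub>W))
               * (1 + c\<^sub>6 * (dist x y / t powr (1 / d\<^sub>W))) powr (- d\<^sub>H - d\<^sub>W) \<le> p t x y \<and>
           p t x y \<le> c\<^sub>3 * t powr (- (d\<^sub>H / d\<^sub>W))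
               * (1 + c\<^sub>4 * (dist x y / t powr (1 / d\<^sub>W))) powr (- d\<^sub>H - d\<^sub>W)"
    and "0 < C"
    and "\<And>f. f \<in> L1_space M \<Longrightarrow> (SUP r\<in>{0<..}. korevaar_schoen M d\<^sub>H f r) < \<infinity> \<Longrightarrow>
           (SUP \<epsilon>\<in>{0<..}. korevaar_schoen M d\<^sub>H f \<epsilon>)
             \<le> ennreal C * Limsup (at_right 0) (\<lambda>\<epsilon>. korevaar_schoen M d\<^sub>H f \<epsilon>)"
  shows "besov_critical_exponent M p = (if d\<^sub>W \<le> 1 then 1 else ereal (1 / d\<^sub>W)) \<and>
         (d\<^sub>W \<le> 1 \<longrightarrow>
         besov M p (real_of_ereal (besov_critical_exponent M p)) =
           {f \<in> L1_space M.
             (\<integral>\<^sup>+ z. ennreal (\<bar>f (fst z) - f (snd z)\<bar> / dist (fst z) (snd z) powr (d\<^sub>H + d\<^sub>W))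
                \<partial>(M \<Otimes>\<^sub>M M)) < \<infinity>}) \<and>
         (1 < d\<^sub>W \<longrightarrow>
         besov M p (real_of_ereal (besov_critical_exponent M p)) =
           {f \<in> L1_space M.
             (SUP r\<in>{0<..}. \<integral>\<^sup>+ z\<in>near_diagonal r.
                ennreal (\<bar>f (fst z) - f (snd z)\<bar> / r powr (d\<^sub>H + 1)) \<partial>(M \<Otimes>\<^sub>M M)) < \<infinity>})"
proof -
  obtain c1 c2 where c: "0 < d\<^sub>H" "c1 > 0" "c2 > 0"
    "\<And>x r. r > 0 \<Longrightarrow> ennreal (c1 * r powr d\<^sub>H) \<le> emeasure M (ball x r)"
    "\<And>x r. r > 0 \<Longrightarrow> emeasure M (ball x r) \<le> ennreal (c2 * r powr d\<^sub>H)"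
    using assms(2) unfolding ahlfors_regular_def by blast
  interpret stable_kernel M d\<^sub>H c1 c2 p d\<^sub>W c\<^sub>3 c\<^sub>4 c\<^sub>5 c\<^sub>6
  proof
    fix t :: real assume t: "0 < t"
    show "(\<lambda>(x, y). p t x y) \<in> borel_measurable (M \<Otimes>\<^sub>M M)"
      using assms(8) t by (simp add: heat_kernel_def)
    show "AE z in M \<Otimes>\<^sub>M M.
      c\<^sub>5 * profile d\<^sub>H d\<^sub>W c\<^sub>6 (dist (fst z) (snd z)) t \<le> p t (fst z) (snd z) \<and>
      p t (fst z) (snd z) \<le> c\<^sub>3 * profile d\<^sub>H d\<^sub>W c\<^sub>4 (dist (fst z) (snd z)) t"
      using assms(15)
    proof eventually_elim
      case (elim z)
      then show ?case using t by (cases z) (simp add: profile_def mult.assoc)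
    qed
  qed (use assms c in auto)
  have crit: "besov_critical_exponent M p = ereal (if d\<^sub>W \<le> 1 then 1 else 1 / d\<^sub>W)"
  proof (cases "d\<^sub>W \<le> 1")
    case True
    then show ?thesis
      \<comment> \<open>All exponents above 1 give trivial classes, so any upper end greater than 1
        would serve.\<close>
      using critical_exponent_eqI[of 1 2] besov_trivial_above_1 by simp
  next
    case False
    then show ?thesis
      \<comment> \<open>The limsup argument covers the exponents between
        \<open>1 / d\<^sub>W\<close> and 1, and this interval is nonempty because
        \<open>d\<^sub>W > 1\<close>.\<close>
      using critical_exponent_eqI[of "1 / d\<^sub>W" 1] besov_trivial_if_limsup[OF _ _ assms(17)]
      by (simp add: divide_simps)
  qed
  have "besov M p 1 = {f \<in> L1_space M.
      (\<integral>\<^sup>+ z. ennreal (\<bar>f (fst z) - f (snd z)\<bar> / dist (fst z) (snd z) powr (d\<^sub>H + d\<^sub>W)) \<partial>(M \<Otimes>\<^sub>M M)) < \<infinity>}"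
    unfolding besov_def
    by (intro Collect_cong conj_cong refl)
      (subst besov_seminorm_1_finite_iff, auto simp: L1_space_def jump_density_def[abs_def])
  moreover have "besov M p (1 / d\<^sub>W) = {f \<in> L1_space M.
      (SUP r\<in>{0<..}. \<integral>\<^sup>+ z\<in>near_diagonal r.
        ennreal (\<bar>f (fst z) - f (snd z)\<bar> / r powr (d\<^sub>H + 1)) \<partial>(M \<Otimes>\<^sub>M M)) < \<infinity>}"
    if "1 < d\<^sub>W"
    unfolding besov_def
  proof (intro Collect_cong conj_cong refl)
    fix f assume "f \<in> L1_space M"
    then have f: "integrable M f" by (simp add: L1_space_def)
    then have [measurable]: "f \<in> borel_measurable M" by simp
    have "(\<integral>\<^sup>+ z\<in>near_diagonal r. ennreal (\<bar>f (fst z) - f (snd z)\<bar> / r powr (d\<^sub>H + 1)) \<partial>(M \<Otimes>\<^sub>M M))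
        = ennreal (r powr - (d\<^sub>H + 1)) * oscillation f r" for r
      unfolding oscillation_def powr_minus divide_inverse
      by (subst nn_integral_cmult[symmetric]) (simp_all add: ennreal_mult' mult_ac)
    then have "(SUP r\<in>{0<..}. \<integral>\<^sup>+ z\<in>near_diagonal r.
        ennreal (\<bar>f (fst z) - f (snd z)\<bar> / r powr (d\<^sub>H + 1)) \<partial>(M \<Otimes>\<^sub>M M)) < \<infinity> \<longleftrightarrow>
      (\<exists>A\<ge>0. \<forall>r>0. oscillation f r \<le> ennreal (A * r powr (d\<^sub>H + 1)))"
      by (simp only: SUP_powr_finite_iff)
    then show "besov_seminorm M p (1 / d\<^sub>W) f < \<infinity> \<longleftrightarrow> (SUP r\<in>{0<..}. \<integral>\<^sup>+ z\<in>near_diagonal r.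
        ennreal (\<bar>f (fst z) - f (snd z)\<bar> / r powr (d\<^sub>H + 1)) \<partial>(M \<Otimes>\<^sub>M M)) < \<infinity>"
      \<comment> \<open>Since \<open>d\<^sub>W > 1\<close>, the exponent
        \<open>1 / d\<^sub>W\<close> is below 1 and the oscillation criterion applies; its power of
        the radius is \<open>d\<^sub>H + 1\<close>.\<close>
      using besov_seminorm_finite_iff_oscillation[OF f, of "1 / d\<^sub>W"] that by simp
  qed
  ultimately show ?thesis by (auto simp: crit)
qed

end
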